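(* For $r\in(-1,1)$ let $b_r(z)=\frac{z-r}{1-rz}$ and for $r\in(-1,0)$ let $f_{r,-r}(z)=\frac{1}{\sqrt2}\left(b_r(z)^2,\,b_{-r}(z)^2\right)$, $z\in\mathbb{D}$. Then for $r,s\in(-1,0)$, the algebras $\mathcal{M}_{f_{r,-r}}$ and $\mathcal{M}_{f_{s,-s}}$ are isomorphic as algebras if and only if $\mathcal{M}_{f_{r,-r}}=\mathcal{M}_{f_{s,-s}}$.
   Context: $\mathbb{D}$ is the open unit disc and $\mathbb{B}_2$ the open unit ball of $\mathbb{C}^2$. For an analytic map $h:\mathbb{D}\to\mathbb{B}_2$, $\mathcal{H}_h$ denotes the reproducing kernel Hilbert space on $\mathbb{D}$ with kernel $k^h(z,w)=1/(1-\langle h(z),h(w)\rangle)$ and $\mathcal{M}_h$ its multiplier algebra (equal to $\{\varphi\circ h:\varphi\in\mathcal{M}_2\}$, where $\mathcal{M}_2$ is the multiplier algebra of the Drury–Arveson space on $\mathbb{B}_2$ with kernel $1/(1-\langle z,w\rangle)$). For these parameters, $f_{r,-r}(\mathbb{D})$ is a variety in $\mathbb{B}_2$ (an analytic disc attached to the unit sphere) whose only boundary self-crossing is $f_{r,-r}(1)=f_{r,-r}(-1)$. *)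

theory Defs
  imports "HOL-Analysis.Analysis"
begin

definition inner2 :: "complex \<times> complex \<Rightarrow> complex \<times> complex \<Rightarrow> complex" where
  "inner2 a b = fst a * cnj (fst b) + snd a * cnj (snd b)"

definition unit_disc :: "complex set" where
  "unit_disc = {z. norm z < 1}"

definition pos_kernel :: "'a set \<Rightarrow> ('a \<Rightarrow> 'a \<Rightarrow> complex) \<Rightarrow> bool" where
  "pos_kernel S K \<longleftrightarrow>
     (\<forall>(n::nat) (x::nat \<Rightarrow> 'a) (c::nat \<Rightarrow> complex). (\<forall>i<n. x i \<in> S) \<longrightarrow>
        (let s = (\<Sum>i<n. \<Sum>j<n. c i * cnj (c j) * K (x i) (x j)) in Im s = 0 \<and> 0 \<le> Re s))"

text \<open>The reproducing kernel Hilbert space with kernel K on S, as a set of functions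
  (vanishing off S): f belongs to it iff c^2 K(z,w) - f(z) conj(f(w)) is a positive kernel
  for some c (Aronszajn's characterization of membership).\<close>
definition rkhs :: "'a set \<Rightarrow> ('a \<Rightarrow> 'a \<Rightarrow> complex) \<Rightarrow> ('a \<Rightarrow> complex) set" where
  "rkhs S K = {f. (\<forall>z. z \<notin> S \<longrightarrow> f z = 0) \<and>
     (\<exists>c::real. pos_kernel S (\<lambda>z w. complex_of_real (c\<^sup>2) * K z w - f z * cnj (f w)))}"

definition multipliers :: "'a set \<Rightarrow> ('a \<Rightarrow> 'a \<Rightarrow> complex) \<Rightarrow> ('a \<Rightarrow> complex) set" where
  "multipliers S K = {\<phi>. (\<forall>z. z \<notin> S \<longrightarrow> \<phi> z = 0) \<and>
     (\<forall>f \<in> rkhs S K. (\<lambda>z. \<phi> z * f z) \<in> rkhs S K)}"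

definition kernel_h :: "(complex \<Rightarrow> complex \<times> complex) \<Rightarrow> complex \<Rightarrow> complex \<Rightarrow> complex" where
  "kernel_h h z w = 1 / (1 - inner2 (h z) (h w))"

definition mult_alg :: "(complex \<Rightarrow> complex \<times> complex) \<Rightarrow> (complex \<Rightarrow> complex) set" where
  "mult_alg h = multipliers unit_disc (kernel_h h)"

definition alg_isomorphic :: "('a \<Rightarrow> complex) set \<Rightarrow> ('b \<Rightarrow> complex) set \<Rightarrow> bool" where
  "alg_isomorphic A B \<longleftrightarrow> (\<exists>\<Phi>. bij_betw \<Phi> A B \<and>
     (\<forall>a\<in>A. \<forall>b\<in>A. \<Phi> (\<lambda>z. a z + b z) = (\<lambda>z. \<Phi> a z + \<Phi> b z) \<and>
                     \<Phi> (\<lambda>z. a z * b z) = (\<lambda>z. \<Phi> a z * \<Phi> b z)) \<and>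
     (\<forall>a\<in>A. \<forall>c::complex. \<Phi> (\<lambda>z. c * a z) = (\<lambda>z. c * \<Phi> a z)))"

definition blaschke :: "real \<Rightarrow> complex \<Rightarrow> complex" where
  "blaschke r z = (z - complex_of_real r) / (1 - complex_of_real r * z)"

definition f_map :: "real \<Rightarrow> complex \<Rightarrow> complex \<times> complex" where
  "f_map r z = ((blaschke r z)\<^sup>2 / complex_of_real (sqrt 2),
                (blaschke (-r) z)\<^sup>2 / complex_of_real (sqrt 2))"

end

theory Submission
  imports Defs "HOL-Complex_Analysis.Complex_Analysis"
begin

text \<open>
  Write \<open>X = b\<^sub>r\<^sup>2\<close>, \<open>Y = b\<^sub>-\<^sub>r\<^sup>2\<close>, K for the kernel, H for its space and M for its
  multiplier algebra. Comparison of K with the Szego kernel shows that H lies in the Hardy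
  space, while \<open>m = (1 - X) * (1 - Y)\<close> maps the Hardy space into H; hence M contains
  \<open>m * \<psi>\<close> for all bounded holomorphic \<open>\<psi>\<close>. A character of M that does not annihilate m
  therefore extends to the bounded holomorphic functions and is a point evaluation if it sends
  the coordinate into the open disc; a character that annihilates m takes the value 1 at
  \<open>g = (X + Y) / 2\<close>. By the maximum principle, an isomorphism between two such algebras can
  only be composition with an automorphism F of the disc.

  The two branches of the disc meeting at the crossing come so close that \<open>\<phi> t - \<phi> (- t)\<close>
  tends to 0 as t tends to 1 along suitable sequences, for every \<open>\<phi> \<in> M\<close>. Applied to
  \<open>X \<circ> F\<close> and \<open>Y \<circ> F\<close> this shows that F maps \<open>{1, -1}\<close> to itself, so that up to sign
  it is a hyperbolic translation along \<open>(-1, 1)\<close>; applied to \<open>(1 - g) powr (\<i> \<tau>) \<circ> F\<close>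
  it shows that the translation is trivial. So F is z or -z, and both preserve M because
  \<open>z \<mapsto> -z\<close> exchanges X and Y.
\<close>

section \<open>Positive kernels\<close>

text \<open>Members of M are only assumed to map H into itself; they carry no norm, and characters
  carry no continuity. Elements of M are therefore produced through the positivity condition
  \<open>bounded_multiplier\<close>, checked by explicit sums of positive kernels, and characters
  are controlled by algebraic identities and by inverting elements inside M. The comparison with the
  Hardy space works because 1 minus the kernel of a Blaschke factor contains the factor
  \<open>1 - z * cnj w\<close>. Both coordinates share it, so the Szego kernel is a sum of four
  congruences of K, and one summand already bounds K. A bound of the Szego kernel by K cannot hold:
  it would put the coordinate z into M, while members of M take asymptotically equal values on the
  two sheets. The factor m, which vanishes at 1 and -1, repairs this. The parameters r and s are
  never compared. The isomorphism is forced to be the identity or the reflection, and the image of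
  the first algebra under either is that algebra itself.\<close>

definition quad :: "('a \<Rightarrow> 'a \<Rightarrow> complex) \<Rightarrow> nat \<Rightarrow> (nat \<Rightarrow> 'a) \<Rightarrow> (nat \<Rightarrow> complex) \<Rightarrow> complex" where
  "quad K n x c = (\<Sum>i<n. \<Sum>j<n. c i * cnj (c j) * K (x i) (x j))"

lemma pos_kernel_iff:
  "pos_kernel S K \<longleftrightarrow> (\<forall>n x c. (\<forall>i<n. x i \<in> S) \<longrightarrow> quad K n x c \<in> \<real>\<^sub>\<ge>\<^sub>0)"
  unfolding pos_kernel_def quad_def Let_def complex_nonneg_Reals_iff by blast

lemma pos_kernelI:
  "(\<And>n x c. (\<And>i. i < n \<Longrightarrow> x i \<in> S) \<Longrightarrow> quad K n x c \<in> \<real>\<^sub>\<ge>\<^sub>0) \<Longrightarrow> pos_kernel S K"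
  by (auto simp: pos_kernel_iff)

lemma pos_kernelD:
  "pos_kernel S K \<Longrightarrow> (\<And>i. i < n \<Longrightarrow> x i \<in> S) \<Longrightarrow> quad K n x c \<in> \<real>\<^sub>\<ge>\<^sub>0"
  by (auto simp: pos_kernel_iff)

lemma quad_cong:
  "(\<And>i j. i < n \<Longrightarrow> j < n \<Longrightarrow> K (x i) (x j) = L (x i) (x j)) \<Longrightarrow> quad K n x c = quad L n x c"
  by (simp add: quad_def)

lemma quad_add: "quad (\<lambda>z w. K z w + L z w) n x c = quad K n x c + quad L n x c"
  by (simp add: quad_def sum.distrib algebra_simps)

lemma quad_diff: "quad (\<lambda>z w. K z w - L z w) n x c = quad K n x c - quad L n x c"
  by (simp add: quad_def sum_subtractf algebra_simps)

lemma quad_scale: "quad (\<lambda>z w. a * K z w) n x c = a * quad K n x c"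
  by (simp add: quad_def sum_distrib_left algebra_simps)

lemma quad_rank_one:
  "quad (\<lambda>z w. f z * cnj (f w)) n x c = of_real ((cmod (\<Sum>i<n. c i * f (x i)))\<^sup>2)"
  unfolding complex_norm_square quad_def
  by (simp add: sum_product cnj_sum algebra_simps)

lemma quad_congruence:
  "quad (\<lambda>z w. f z * cnj (f w) * K z w) n x c = quad K n x (\<lambda>i. c i * f (x i))"
  by (simp add: quad_def algebra_simps)

lemma pos_kernel_cong:
  assumes "pos_kernel S K" "\<And>z w. z \<in> S \<Longrightarrow> w \<in> S \<Longrightarrow> L z w = K z w"
  shows "pos_kernel S L"
proof (rule pos_kernelI)
  fix n and x :: "nat \<Rightarrow> 'a" and c assume x: "\<And>i. i < n \<Longrightarrow> x i \<in> S"
  have "quad L n x c = quad K n x c" by (rule quad_cong) (use assms(2) x in auto)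
  then show "quad L n x c \<in> \<real>\<^sub>\<ge>\<^sub>0" using pos_kernelD[OF assms(1) x] by simp
qed

lemma pos_kernel_add:
  "pos_kernel S K \<Longrightarrow> pos_kernel S L \<Longrightarrow> pos_kernel S (\<lambda>z w. K z w + L z w)"
  by (auto simp: pos_kernel_iff quad_add)

lemma pos_kernel_scale:
  "pos_kernel S K \<Longrightarrow> a \<ge> 0 \<Longrightarrow> pos_kernel S (\<lambda>z w. complex_of_real a * K z w)"
  by (auto simp: pos_kernel_iff quad_scale)

lemma pos_kernel_rank_one: "pos_kernel S (\<lambda>z w. f z * cnj (f w))"
  by (auto simp: pos_kernel_iff quad_rank_one simp del: of_real_power)

lemma pos_kernel_one: "pos_kernel S (\<lambda>z w. 1)"
  using pos_kernel_rank_one[of S "\<lambda>_. 1"] by simp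

lemma pos_kernel_congruence:
  "pos_kernel S K \<Longrightarrow> pos_kernel S (\<lambda>z w. f z * cnj (f w) * K z w)"
  by (auto simp: pos_kernel_iff quad_congruence)

lemma pos_kernel_pullback:
  assumes "pos_kernel T K" "\<And>z. z \<in> S \<Longrightarrow> h z \<in> T"
  shows "pos_kernel S (\<lambda>z w. K (h z) (h w))"
proof (rule pos_kernelI)
  fix n and x :: "nat \<Rightarrow> 'b" and c assume "\<And>i. i < n \<Longrightarrow> x i \<in> S"
  then show "quad (\<lambda>z w. K (h z) (h w)) n x c \<in> \<real>\<^sub>\<ge>\<^sub>0"
    using pos_kernelD[OF assms(1), of n "h \<circ> x" c] assms(2) by (simp add: quad_def)
qed

lemma pos_kernel_limit:
  fixes K :: "'a \<Rightarrow> 'a \<Rightarrow> complex"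
  assumes "eventually (\<lambda>t. pos_kernel S (P t)) F" "F \<noteq> bot"
    and "\<And>z w. z \<in> S \<Longrightarrow> w \<in> S \<Longrightarrow> ((\<lambda>t. P t z w) \<longlongrightarrow> K z w) F"
  shows "pos_kernel S K"
proof (rule pos_kernelI)
  fix n and x :: "nat \<Rightarrow> 'a" and c assume x: "\<And>i. i < n \<Longrightarrow> x i \<in> S"
  have "((\<lambda>t. quad (P t) n x c) \<longlongrightarrow> quad K n x c) F"
    unfolding quad_def by (intro tendsto_intros assms(3) x) auto
  moreover have "eventually (\<lambda>t. quad (P t) n x c \<in> \<real>\<^sub>\<ge>\<^sub>0) F"
    using assms(1) by eventually_elim (rule pos_kernelD[OF _ x])
  ultimately show "quad K n x c \<in> \<real>\<^sub>\<ge>\<^sub>0"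
    using assms(2) closed_nonneg_Reals_complex by (metis Lim_in_closed_set)
qed

text \<open>The partial sums of the geometric series in \<open>L\<close> are positive and converge
  pointwise. The second assumption is positivity of \<open>L\<close> in operator form; for a sum of
  rank one kernels it follows from congruence and addition.\<close>

lemma pos_kernel_geometric:
  fixes L :: "'a \<Rightarrow> 'a \<Rightarrow> complex"
  assumes P: "pos_kernel S P"
    and L: "\<And>P. pos_kernel S P \<Longrightarrow> pos_kernel S (\<lambda>z w. L z w * P z w)"
    and lt: "\<And>z w. z \<in> S \<Longrightarrow> w \<in> S \<Longrightarrow> cmod (L z w) < 1"
  shows "pos_kernel S (\<lambda>z w. P z w / (1 - L z w))"
proof -
  have pw: "pos_kernel S (\<lambda>z w. L z w ^ n * P z w)" for n
  proof (induction n)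
    case (Suc n) from L[OF this] show ?case by (simp add: mult.assoc)
  qed (use P in simp)
  have ps: "pos_kernel S (\<lambda>z w. \<Sum>n\<le>N. L z w ^ n * P z w)" for N
  proof (induction N)
    case (Suc N) from pos_kernel_add[OF this pw[of "Suc N"]] show ?case by simp
  qed (use P in simp)
  show ?thesis
  proof (rule pos_kernel_limit[where F = sequentially])
    show "\<forall>\<^sub>F N in sequentially. pos_kernel S (\<lambda>z w. \<Sum>n\<le>N. L z w ^ n * P z w)"
      using ps by simp
    fix z w assume "z \<in> S" "w \<in> S"
    then have "(\<lambda>n. L z w ^ n * P z w) sums (1 / (1 - L z w) * P z w)"
      by (intro sums_mult2 geometric_sums lt)
    then show "(\<lambda>N. \<Sum>n\<le>N. L z w ^ n * P z w) \<longlonglongrightarrow> P z w / (1 - L z w)"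
      unfolding sums_def_le by simp
  qed simp
qed

lemma pos_kernel_diag: "pos_kernel S K \<Longrightarrow> a \<in> S \<Longrightarrow> K a a \<in> \<real>\<^sub>\<ge>\<^sub>0"
  using pos_kernelD[of S K 1 "\<lambda>_. a" "\<lambda>_. 1"] by (simp add: quad_def)

text \<open>This is the kernel of the functions that vanish at \<open>a\<close>. The form of
  \<open>K\<close> at the given points together with \<open>a\<close> is nonnegative for every
  coefficient at \<open>a\<close>, and the best coefficient gives the claim.\<close>

lemma pos_kernel_schur_complement:
  fixes K :: "'a \<Rightarrow> 'a \<Rightarrow> complex"
  assumes K: "pos_kernel S K" and a: "a \<in> S" and nz: "K a a \<noteq> 0"
  shows "pos_kernel S (\<lambda>z w. K z w - K z a * K a w / K a a)"
proof (rule pos_kernelI)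
  fix n and x :: "nat \<Rightarrow> 'a" and c :: "nat \<Rightarrow> complex"
  assume x: "\<And>i. i < n \<Longrightarrow> x i \<in> S"
  define d where "d = K a a"
  have d: "cnj d = d" "d \<noteq> 0"
    using pos_kernel_diag[OF K a] nz by (auto simp: d_def complex_nonneg_Reals_iff complex_eq_iff)
  define u where "u = (\<Sum>i<n. c i * K (x i) a)"
  define v where "v = (\<Sum>j<n. cnj (c j) * K a (x j))"
  define x' where "x' = (\<lambda>i. if i < n then x i else a)"
  \<comment> \<open>\<open>- u / d\<close> minimises the form as a function of the coefficient at
    \<open>a\<close>; with it the last two of the four terms below cancel.\<close>
  define c' where "c' = (\<lambda>i. if i < n then c i else - u / d)"
  have "quad K (Suc n) x' c' \<in> \<real>\<^sub>\<ge>\<^sub>0"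
    using pos_kernelD[OF K, of "Suc n" x' c'] x a by (simp add: x'_def)
  also have "quad K (Suc n) x' c' =
      quad K n x c + (- u / d) * v + cnj (- u / d) * u + (- u / d) * cnj (- u / d) * d"
  proof -
    have "quad K (Suc n) x' c' =
        (\<Sum>i<n. (\<Sum>j<n. c i * cnj (c j) * K (x i) (x j)) + cnj (- u / d) * (c i * K (x i) a))
        + ((\<Sum>j<n. (- u / d) * (cnj (c j) * K a (x j))) + (- u / d) * cnj (- u / d) * d)"
      unfolding quad_def sum.lessThan_Suc by (simp add: x'_def c'_def d_def mult.assoc mult.left_commute)
    also have "\<dots> = (quad K n x c + cnj (- u / d) * u)
        + ((- u / d) * v + (- u / d) * cnj (- u / d) * d)"
      by (simp only: quad_def sum.distrib sum_distrib_left u_def v_def)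
    finally show ?thesis by simp
  qed
  also have "\<dots> = quad K n x c - u * v / d"
    using d by (simp add: field_simps)
  also have "u * v / d = quad (\<lambda>z w. K z a * K a w / K a a) n x c"
    unfolding quad_def u_def v_def d_def
    by (simp add: sum_product sum_divide_distrib algebra_simps)
  finally show "quad (\<lambda>z w. K z w - K z a * K a w / K a a) n x c \<in> \<real>\<^sub>\<ge>\<^sub>0"
    by (simp add: quad_diff)
qed

section \<open>Reproducing kernel spaces and their multipliers\<close>

text \<open>The kernel criterion for multiplication by \<phi> to have norm at most
  \<open>sqrt C\<close>. It serves to construct multipliers; an arbitrary member of
  \<open>multipliers\<close> is not shown to satisfy it.\<close>

definition bounded_multiplier :: "'a set \<Rightarrow> ('a \<Rightarrow> 'a \<Rightarrow> complex) \<Rightarrow> ('a \<Rightarrow> complex) \<Rightarrow> bool" where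
  "bounded_multiplier S K \<phi> \<longleftrightarrow>
     (\<exists>C\<ge>0. pos_kernel S (\<lambda>z w. (complex_of_real C - \<phi> z * cnj (\<phi> w)) * K z w))"

lemma rkhs_iff:
  "f \<in> rkhs S K \<longleftrightarrow> (\<forall>z. z \<notin> S \<longrightarrow> f z = 0) \<and>
     (\<exists>C\<ge>0. pos_kernel S (\<lambda>z w. complex_of_real C * K z w - f z * cnj (f w)))"
proof -
  have "(\<exists>c. P (c\<^sup>2)) \<longleftrightarrow> (\<exists>C\<ge>0. P C)" for P :: "real \<Rightarrow> bool"
    by (metis zero_le_power2 real_sqrt_pow2)
  from this[of "\<lambda>C. pos_kernel S (\<lambda>z w. complex_of_real C * K z w - f z * cnj (f w))"]
  show ?thesis unfolding rkhs_def mem_Collect_eq by simp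
qed

lemma rkhsI:
  assumes "\<And>z. z \<notin> S \<Longrightarrow> f z = 0" "C \<ge> 0"
    "pos_kernel S (\<lambda>z w. complex_of_real C * K z w - f z * cnj (f w))"
  shows "f \<in> rkhs S K"
  using assms by (auto simp: rkhs_iff)

lemma rkhsE:
  assumes "f \<in> rkhs S K" "pos_kernel S K"
  obtains C where "C > 0" "pos_kernel S (\<lambda>z w. complex_of_real C * K z w - f z * cnj (f w))"
proof -
  obtain C where C: "C \<ge> 0" "pos_kernel S (\<lambda>z w. complex_of_real C * K z w - f z * cnj (f w))"
    using assms(1) by (auto simp: rkhs_iff)
  have "pos_kernel S (\<lambda>z w. complex_of_real (C + 1) * K z w - f z * cnj (f w))"
    by (rule pos_kernel_cong[OF pos_kernel_add[OF C(2) assms(2)]]) (simp add: algebra_simps)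
  with C(1) show ?thesis by (intro that[of "C + 1"]) auto
qed

lemma rkhs_outside: "f \<in> rkhs S K \<Longrightarrow> z \<notin> S \<Longrightarrow> f z = 0"
  by (simp add: rkhs_def)

text \<open>\<open>quad K n x c\<close> is the squared norm of the functional that sends f to
  \<open>\<Sum>i<n. c i * f (x i)\<close>, and C bounds the squared norm of f. All later pointwise
  estimates are instances with one, two or three points.\<close>

lemma rkhs_functional_bound:
  assumes "pos_kernel S (\<lambda>z w. complex_of_real C * K z w - f z * cnj (f w))"
    and "\<And>i. i < n \<Longrightarrow> x i \<in> S"
  shows "(cmod (\<Sum>i<n. c i * f (x i)))\<^sup>2 \<le> C * Re (quad K n x c)"
  using pos_kernelD[OF assms, where c = c]
  by (simp add: quad_diff quad_scale quad_rank_one complex_nonneg_Reals_iff del: of_real_power)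

lemma rkhsI_functional_bound:
  assumes K: "pos_kernel S K" and "\<And>z. z \<notin> S \<Longrightarrow> f z = 0" "C \<ge> 0"
    and le: "\<And>n x c. (\<And>i. i < n \<Longrightarrow> x i \<in> S) \<Longrightarrow>
        (cmod (\<Sum>i<n. c i * f (x i)))\<^sup>2 \<le> C * Re (quad K n x c)"
  shows "f \<in> rkhs S K"
proof (rule rkhsI[OF assms(2,3)], assumption, rule pos_kernelI)
  fix n and x :: "nat \<Rightarrow> 'a" and c assume x: "\<And>i. i < n \<Longrightarrow> x i \<in> S"
  show "quad (\<lambda>z w. complex_of_real C * K z w - f z * cnj (f w)) n x c \<in> \<real>\<^sub>\<ge>\<^sub>0"
    using pos_kernelD[OF K x, where c = c] le[OF x, where c = c]
    by (simp add: quad_diff quad_scale quad_rank_one complex_nonneg_Reals_iff del: of_real_power)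
qed

text \<open>Parallelogram law: adding the rank one kernel of f - g to that of f + g gives twice the
  kernels of f and of g, hence the constant 2 * A + 2 * B. \<open>bounded_multiplier_add\<close>
  uses the same device.\<close>

lemma rkhs_add:
  assumes "f \<in> rkhs S K" "g \<in> rkhs S K"
  shows "(\<lambda>z. f z + g z) \<in> rkhs S K"
proof -
  obtain A B where A: "A \<ge> 0" "pos_kernel S (\<lambda>z w. complex_of_real A * K z w - f z * cnj (f w))"
    and B: "B \<ge> 0" "pos_kernel S (\<lambda>z w. complex_of_real B * K z w - g z * cnj (g w))"
    using assms by (auto simp: rkhs_iff)
  have "pos_kernel S (\<lambda>z w. complex_of_real (2 * A + 2 * B) * K z w
          - (f z + g z) * cnj (f w + g w))"
    by (rule pos_kernel_cong[OF pos_kernel_add[OF pos_kernel_rank_one[of S "\<lambda>z. f z - g z"]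
          pos_kernel_scale[OF pos_kernel_add[OF A(2) B(2)], of 2]]])
      (auto simp: algebra_simps)
  then show ?thesis using A(1) B(1) assms
    by (intro rkhsI[of _ _ "2 * A + 2 * B"]) (auto simp: rkhs_outside)
qed

lemma rkhs_scale:
  assumes "f \<in> rkhs S K"
  shows "(\<lambda>z. a * f z) \<in> rkhs S K"
proof -
  obtain A where A: "A \<ge> 0" "pos_kernel S (\<lambda>z w. complex_of_real A * K z w - f z * cnj (f w))"
    using assms by (auto simp: rkhs_iff)
  have "pos_kernel S (\<lambda>z w. complex_of_real ((cmod a)\<^sup>2 * A) * K z w - (a * f z) * cnj (a * f w))"
    by (rule pos_kernel_cong[OF pos_kernel_scale[OF A(2), of "(cmod a)\<^sup>2"]])
      (simp_all only: of_real_mult complex_norm_square, simp_all add: algebra_simps)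
  then show ?thesis using A(1) assms
    by (intro rkhsI[of _ _ "(cmod a)\<^sup>2 * A"]) (auto simp: rkhs_outside)
qed

lemma rkhs_mono:
  assumes "f \<in> rkhs S K" "C \<ge> 0" "pos_kernel S (\<lambda>z w. complex_of_real C * L z w - K z w)"
  shows "f \<in> rkhs S L"
proof -
  obtain A where A: "A \<ge> 0" "pos_kernel S (\<lambda>z w. complex_of_real A * K z w - f z * cnj (f w))"
    using assms by (auto simp: rkhs_iff)
  have "pos_kernel S (\<lambda>z w. complex_of_real (A * C) * L z w - f z * cnj (f w))"
    by (rule pos_kernel_cong[OF pos_kernel_add[OF A(2) pos_kernel_scale[OF assms(3) A(1)]]])
      (simp add: algebra_simps)
  then show ?thesis using A(1) assms by (intro rkhsI[of _ _ "A * C"]) (auto simp: rkhs_outside)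
qed

lemma rkhs_mult:
  assumes f: "f \<in> rkhs S K" and C: "C \<ge> 0"
    and pos: "pos_kernel S (\<lambda>z w. complex_of_real C * L z w - m z * cnj (m w) * K z w)"
  shows "(\<lambda>z. m z * f z) \<in> rkhs S L"
proof -
  obtain A where A: "A \<ge> 0" "pos_kernel S (\<lambda>z w. complex_of_real A * K z w - f z * cnj (f w))"
    using f by (auto simp: rkhs_iff)
  have "pos_kernel S (\<lambda>z w. complex_of_real (A * C) * L z w - (m z * f z) * cnj (m w * f w))"
    by (rule pos_kernel_cong[OF pos_kernel_add[OF pos_kernel_congruence[OF A(2), of m]
          pos_kernel_scale[OF pos A(1)]]])
      (simp add: algebra_simps)
  then show ?thesis using A(1) C f by (intro rkhsI[of _ _ "A * C"]) (auto simp: rkhs_outside)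
qed

lemma bounded_multiplier_rkhs:
  assumes "bounded_multiplier S K \<phi>" "f \<in> rkhs S K"
  shows "(\<lambda>z. \<phi> z * f z) \<in> rkhs S K"
proof -
  obtain C where C: "C \<ge> 0" "pos_kernel S (\<lambda>z w. (complex_of_real C - \<phi> z * cnj (\<phi> w)) * K z w)"
    using assms(1) by (auto simp: bounded_multiplier_def)
  show ?thesis
    by (rule rkhs_mult[OF assms(2) C(1) pos_kernel_cong[OF C(2)]]) (simp add: algebra_simps)
qed

lemma bounded_multiplier_const:
  assumes "pos_kernel S K" shows "bounded_multiplier S K (\<lambda>z. a)"
  unfolding bounded_multiplier_def
  by (rule exI[of _ "(cmod a)\<^sup>2"], simp only: complex_norm_square)
    (simp add: pos_kernel_scale[OF assms, of 0, simplified])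

text \<open>A * B minus the kernel of \<phi> * \<psi> splits into the congruence by \<psi> of A
  minus the kernel of \<phi>, and A times B minus the kernel of \<psi>.\<close>

lemma bounded_multiplier_mult:
  assumes "bounded_multiplier S K \<phi>" "bounded_multiplier S K \<psi>"
  shows "bounded_multiplier S K (\<lambda>z. \<phi> z * \<psi> z)"
proof -
  obtain A B where A: "A \<ge> 0" "pos_kernel S (\<lambda>z w. (complex_of_real A - \<phi> z * cnj (\<phi> w)) * K z w)"
    and B: "B \<ge> 0" "pos_kernel S (\<lambda>z w. (complex_of_real B - \<psi> z * cnj (\<psi> w)) * K z w)"
    using assms by (auto simp: bounded_multiplier_def)
  have "pos_kernel S (\<lambda>z w. (complex_of_real (A * B) - (\<phi> z * \<psi> z) * cnj (\<phi> w * \<psi> w)) * K z w)"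
    by (rule pos_kernel_cong[OF pos_kernel_add[OF pos_kernel_congruence[OF A(2), of \<psi>]
          pos_kernel_scale[OF B(2) A(1)]]])
      (simp add: algebra_simps)
  then show ?thesis using A B unfolding bounded_multiplier_def by (intro exI[of _ "A * B"]) auto
qed

lemma bounded_multiplier_add:
  assumes K: "pos_kernel S K" and "bounded_multiplier S K \<phi>" "bounded_multiplier S K \<psi>"
  shows "bounded_multiplier S K (\<lambda>z. \<phi> z + \<psi> z)"
proof -
  obtain A B where A: "A \<ge> 0" "pos_kernel S (\<lambda>z w. (complex_of_real A - \<phi> z * cnj (\<phi> w)) * K z w)"
    and B: "B \<ge> 0" "pos_kernel S (\<lambda>z w. (complex_of_real B - \<psi> z * cnj (\<psi> w)) * K z w)"
    using assms by (auto simp: bounded_multiplier_def)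
  have "pos_kernel S (\<lambda>z w. (complex_of_real (2 * A + 2 * B)
            - (\<phi> z + \<psi> z) * cnj (\<phi> w + \<psi> w)) * K z w)"
    by (rule pos_kernel_cong[OF pos_kernel_add[OF pos_kernel_congruence[OF K, of "\<lambda>z. \<phi> z - \<psi> z"]
          pos_kernel_scale[OF pos_kernel_add[OF A(2) B(2)], of 2]]])
      (auto simp: algebra_simps)
  then show ?thesis using A B unfolding bounded_multiplier_def
    by (intro exI[of _ "2 * A + 2 * B"]) auto
qed

lemma multipliersI:
  assumes "bounded_multiplier S K \<phi>" "\<And>z. z \<notin> S \<Longrightarrow> \<phi> z = 0"
  shows "\<phi> \<in> multipliers S K"
  using assms bounded_multiplier_rkhs[OF assms(1)] by (auto simp: multipliers_def)

lemma multipliers_outside: "\<phi> \<in> multipliers S K \<Longrightarrow> z \<notin> S \<Longrightarrow> \<phi> z = 0"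
  by (simp add: multipliers_def)

lemma multipliersD: "\<phi> \<in> multipliers S K \<Longrightarrow> f \<in> rkhs S K \<Longrightarrow> (\<lambda>z. \<phi> z * f z) \<in> rkhs S K"
  by (simp add: multipliers_def)

lemma multipliers_add:
  assumes "\<phi> \<in> multipliers S K" "\<psi> \<in> multipliers S K"
  shows "(\<lambda>z. \<phi> z + \<psi> z) \<in> multipliers S K"
  using rkhs_add[of "\<lambda>z. \<phi> z * f z" S K "\<lambda>z. \<psi> z * f z" for f] assms
  by (auto simp: multipliers_def distrib_right)

lemma multipliers_mult:
  assumes "\<phi> \<in> multipliers S K" "\<psi> \<in> multipliers S K"
  shows "(\<lambda>z. \<phi> z * \<psi> z) \<in> multipliers S K"
  using assms by (auto simp: multipliers_def mult.assoc)

lemma multipliers_scale: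
  assumes "\<phi> \<in> multipliers S K"
  shows "(\<lambda>z. a * \<phi> z) \<in> multipliers S K"
  using rkhs_scale[of "\<lambda>z. \<phi> z * f z" S K a for f] assms
  by (auto simp: multipliers_def mult.assoc)

lemma multipliers_indicator:
  "(\<lambda>z. if z \<in> S then 1 else 0) \<in> multipliers S K"
proof -
  have "(\<lambda>z. (if z \<in> S then 1 else 0) * f z) = f" if "f \<in> rkhs S K" for f
    using that by (auto simp: rkhs_outside)
  then show ?thesis by (auto simp: multipliers_def)
qed

section \<open>The Hardy space of the disc\<close>

definition szego :: "complex \<Rightarrow> complex \<Rightarrow> complex" where
  "szego z w = 1 / (1 - z * cnj w)"

lemma unit_disc_eq: "unit_disc = ball 0 1"
  by (auto simp: unit_disc_def)

lemma mem_unit_disc [simp]: "z \<in> unit_disc \<longleftrightarrow> cmod z < 1"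
  by (simp add: unit_disc_def)

lemma open_unit_disc [simp]: "open unit_disc"
  by (simp add: unit_disc_eq)

lemma norm_mult_cnj_less_one: "cmod z < 1 \<Longrightarrow> cmod w < 1 \<Longrightarrow> cmod (z * cnj w) < 1"
  using norm_mult_less[of z 1 "cnj w" 1] by simp

lemma one_minus_mult_cnj_nonzero:
  assumes "cmod z \<le> 1" "cmod w < 1"
  shows "1 - z * cnj w \<noteq> 0" "1 - cnj w * z \<noteq> 0"
proof -
  have "cmod (z * cnj w) < 1"
    using assms mult_left_le_one_le[of "cmod w" "cmod z"] by (simp add: norm_mult)
  then show "1 - z * cnj w \<noteq> 0" "1 - cnj w * z \<noteq> 0" by (auto simp: mult.commute)
qed

lemma pos_kernel_szego: "pos_kernel unit_disc szego"
  unfolding szego_def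
  by (rule pos_kernel_geometric[OF pos_kernel_one])
    (auto intro: pos_kernel_congruence norm_mult_cnj_less_one)

text \<open>Cauchy's formula on the unit circle: there \<open>cnj (szego e w)\<close> equals
  \<open>e / (e - w)\<close>, and the factor e comes from the derivative of the
  parametrisation.\<close>

lemma szego_reproducing:
  assumes "continuous_on (cball 0 1) h" "h holomorphic_on ball 0 1" "cmod w < 1"
  shows "((\<lambda>t. h (exp (2 * of_real pi * \<i> * of_real t)) *
            cnj (szego (exp (2 * of_real pi * \<i> * of_real t)) w)) has_integral h w) {0..1}"
proof -
  define e where "e = (\<lambda>t::real. exp (2 * of_real pi * \<i> * of_real t))"
  have e: "cmod (e t) = 1" for t
    unfolding e_def using norm_exp_i_times[of "2 * pi * t"] by (simp add: mult_ac)
  have ec: "cnj (e t) = 1 / e t" for t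
    using complex_norm_square[of "e t"] e[of t] by (auto simp: eq_divide_eq mult.commute)
  have cp: "circlepath 0 1 t = e t" for t
    by (simp add: circlepath e_def mult_ac)
  have vd: "vector_derivative (circlepath 0 1) (at t) = 2 * of_real pi * \<i> * e t" for t
    by (simp add: vector_derivative_circlepath e_def mult_ac)
  have "((\<lambda>u. h u / (u - w)) has_contour_integral (2 * of_real pi * \<i> * h w)) (circlepath 0 1)"
    using Cauchy_integral_circlepath[OF assms(1,2)] assms(3) by simp
  then have "((\<lambda>t. h (e t) / (e t - w) * (2 * of_real pi * \<i> * e t)) has_integral
      (2 * of_real pi * \<i> * h w)) {0..1}"
    unfolding has_contour_integral
    by (rule has_integral_eq[rotated]) (simp add: cp vd mult_ac)
  from has_integral_mult_right[OF this, of "1 / (2 * of_real pi * \<i>)"]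
  have "((\<lambda>t. h (e t) * (e t / (e t - w))) has_integral h w) {0..1}"
    by (simp add: mult_ac)
  moreover have "cnj (szego (e t) w) = e t / (e t - w)" for t
  proof -
    have "e t \<noteq> 0" using e[of t] by auto
    then show ?thesis by (simp add: szego_def ec field_simps)
  qed
  ultimately show ?thesis by (simp add: e_def)
qed

lemma continuous_on_szego: "cmod w < 1 \<Longrightarrow> continuous_on (cball 0 1) (\<lambda>z. szego z w)"
  unfolding szego_def by (intro continuous_intros) (use one_minus_mult_cnj_nonzero in auto)

lemma holomorphic_on_szego: "cmod w < 1 \<Longrightarrow> (\<lambda>z. szego z w) holomorphic_on ball 0 1"
  unfolding szego_def by (intro holomorphic_intros) (use one_minus_mult_cnj_nonzero in force)

text \<open>With \<open>f = \<Sum> cnj (c j) * szego _ (x j)\<close> and T its image under the adjoint of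
  multiplication by \<open>\<psi>\<close>, the integral of \<open>|cnj \<psi> * f - T|\<^sup>2\<close> over the circle is
  \<open>\<integral>|\<psi> f|\<^sup>2 - \<integral>|T|\<^sup>2\<close>.\<close>

lemma pos_kernel_szego_contraction_aux:
  assumes c: "continuous_on (cball 0 1) \<psi>" and h: "\<psi> holomorphic_on ball 0 1"
    and B: "\<And>z. cmod z \<le> 1 \<Longrightarrow> cmod (\<psi> z) \<le> B"
  shows "pos_kernel unit_disc (\<lambda>z w. (complex_of_real (B\<^sup>2) - \<psi> z * cnj (\<psi> w)) * szego z w)"
proof (rule pos_kernelI)
  fix n and x :: "nat \<Rightarrow> complex" and c :: "nat \<Rightarrow> complex"
  assume "\<And>i. i < n \<Longrightarrow> x i \<in> unit_disc"
  then have x: "\<And>i. i < n \<Longrightarrow> cmod (x i) < 1" by simp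
  define e where "e = (\<lambda>t::real. exp (2 * of_real pi * \<i> * of_real t))"
  have e: "cmod (e t) = 1" for t
    unfolding e_def using norm_exp_i_times[of "2 * pi * t"] by (simp add: mult_ac)
  define f where "f = (\<lambda>(c::nat \<Rightarrow> complex) z. \<Sum>j<n. cnj (c j) * szego z (x j))"
  have cf: "continuous_on (cball 0 1) (f c)" for c
    unfolding f_def by (intro continuous_intros continuous_on_szego x) auto
  have hf: "f c holomorphic_on ball 0 1" for c
    unfolding f_def by (intro holomorphic_intros holomorphic_on_szego x) auto
  have rep: "((\<lambda>t. h (e t) * cnj (f c (e t))) has_integral (\<Sum>j<n. c j * h (x j))) {0..1}"
    if "continuous_on (cball 0 1) h" "h holomorphic_on ball 0 1" for h c
  proof -
    have "((\<lambda>t. \<Sum>j<n. c j * (h (e t) * cnj (szego (e t) (x j)))) has_integral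
        (\<Sum>j<n. c j * h (x j))) {0..1}"
      unfolding e_def by (intro has_integral_sum has_integral_mult_right szego_reproducing that x) auto
    then show ?thesis by (simp add: f_def sum_distrib_left algebra_simps)
  qed
  \<comment> \<open>\<open>f d\<close> is the T of the remark above: the adjoint of multiplication
    by \<psi> multiplies the kernel function at \<open>x j\<close> by
    \<open>cnj (\<psi> (x j))\<close>, that is, it changes only the coefficients.\<close>
  define d where "d = (\<lambda>i. c i * \<psi> (x i))"
  have q: "(\<Sum>j<n. a j * f a (x j)) = quad szego n x a" for a
    by (simp add: quad_def f_def sum_distrib_left algebra_simps)
  have i1: "((\<lambda>t. f c (e t) * cnj (f c (e t))) has_integral quad szego n x c) {0..1}"
    using rep[OF cf hf, of c c] by (simp add: q)
  have i2: "((\<lambda>t. f d (e t) * cnj (f d (e t))) has_integral quad szego n x d) {0..1}"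
    using rep[OF cf hf, of d d] by (simp add: q)
  have i3: "((\<lambda>t. (\<psi> (e t) * f d (e t)) * cnj (f c (e t))) has_integral quad szego n x d) {0..1}"
  proof -
    have "(\<Sum>j<n. c j * (\<psi> (x j) * f d (x j))) = quad szego n x d"
      unfolding q[symmetric] by (simp add: d_def mult.assoc)
    then show ?thesis
      using rep[of "\<lambda>z. \<psi> z * f d z" c] assms(1,2) cf hf
      by (simp add: continuous_intros holomorphic_intros)
  qed
  have i: "((\<lambda>t. of_real (B\<^sup>2) * (f c (e t) * cnj (f c (e t)))
        - 2 * ((\<psi> (e t) * f d (e t)) * cnj (f c (e t))) + f d (e t) * cnj (f d (e t))) has_integral
      of_real (B\<^sup>2) * quad szego n x c - 2 * quad szego n x d + quad szego n x d) {0..1}"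
    by (intro has_integral_add has_integral_diff has_integral_mult_right i1 i2 i3)
  have "0 \<le> Re (of_real (B\<^sup>2) * quad szego n x c - 2 * quad szego n x d + quad szego n x d)"
  proof (rule has_integral_nonneg[OF has_integral_Re[OF i]])
    fix t :: real
    have "0 \<le> Re ((cnj (\<psi> (e t)) * f c (e t) - f d (e t)) * cnj (cnj (\<psi> (e t)) * f c (e t) - f d (e t)))"
      by (metis Re_complex_of_real complex_norm_square zero_le_power2)
    also have "\<dots> = (cmod (\<psi> (e t)))\<^sup>2 * (cmod (f c (e t)))\<^sup>2
        - 2 * Re ((\<psi> (e t) * f d (e t)) * cnj (f c (e t))) + (cmod (f d (e t)))\<^sup>2"
      unfolding cmod_power2 by (simp add: algebra_simps power2_eq_square)
    also have "\<dots> \<le> B\<^sup>2 * (cmod (f c (e t)))\<^sup>2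
        - 2 * Re ((\<psi> (e t) * f d (e t)) * cnj (f c (e t))) + (cmod (f d (e t)))\<^sup>2"
      using mult_right_mono[OF power_mono[OF B[of "e t"], of 2], of "(cmod (f c (e t)))\<^sup>2"] e[of t]
      by simp
    finally show "0 \<le> Re (of_real (B\<^sup>2) * (f c (e t) * cnj (f c (e t)))
        - 2 * ((\<psi> (e t) * f d (e t)) * cnj (f c (e t))) + f d (e t) * cnj (f d (e t)))"
      by (simp add: complex_mult_cnj cmod_power2 del: of_real_power)
  qed
  moreover have "quad szego n x c \<in> \<real>\<^sub>\<ge>\<^sub>0" "quad szego n x d \<in> \<real>\<^sub>\<ge>\<^sub>0"
    using pos_kernelD[OF pos_kernel_szego] x by auto
  moreover have "quad (\<lambda>z w. (complex_of_real (B\<^sup>2) - \<psi> z * cnj (\<psi> w)) * szego z w) n x c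
      = of_real (B\<^sup>2) * quad szego n x c - quad szego n x d"
    by (simp only: left_diff_distrib quad_diff quad_scale quad_congruence d_def)
  ultimately show "quad (\<lambda>z w. (complex_of_real (B\<^sup>2) - \<psi> z * cnj (\<psi> w)) * szego z w) n x c \<in> \<real>\<^sub>\<ge>\<^sub>0"
    by (simp add: complex_nonneg_Reals_iff del: of_real_power)
qed

text \<open>A bounded \<psi> need not extend continuously to the circle, but its dilates
  \<open>\<psi> (t * z)\<close> with t < 1 do, with the same bound. Positivity survives the limit as
  t tends to 1.\<close>

lemma pos_kernel_szego_contraction:
  assumes h: "\<psi> holomorphic_on unit_disc"
    and B: "\<And>z. cmod z < 1 \<Longrightarrow> cmod (\<psi> z) \<le> B"
  shows "pos_kernel unit_disc (\<lambda>z w. (complex_of_real (B\<^sup>2) - \<psi> z * cnj (\<psi> w)) * szego z w)"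
proof (rule pos_kernel_limit[where F = "at_left (1::real)"
      and P = "\<lambda>t z w. (complex_of_real (B\<^sup>2) - \<psi> (of_real t * z) * cnj (\<psi> (of_real t * w))) * szego z w"])
  have "eventually (\<lambda>t. t \<in> {0<..<1}) (at_left (1::real))"
    using eventually_at_left_real[of 0 1] by simp
  then show "\<forall>\<^sub>F t in at_left 1. pos_kernel unit_disc
      (\<lambda>z w. (complex_of_real (B\<^sup>2) - \<psi> (of_real t * z) * cnj (\<psi> (of_real t * w))) * szego z w)"
  proof eventually_elim
    case (elim t)
    have t: "cmod (of_real t * z) < 1" if "cmod z \<le> 1" for z
      using elim le_less_trans[OF mult_left_le[OF that, of t], of 1] by (simp add: norm_mult)
    have hh: "(\<lambda>z. \<psi> (of_real t * z)) holomorphic_on cball 0 1"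
      using holomorphic_on_compose_gen[OF _ h, of "\<lambda>z. of_real t * z" "cball 0 1"] t
      by (simp add: o_def image_subset_iff holomorphic_intros)
    show ?case
      by (rule pos_kernel_szego_contraction_aux)
        (use hh t B in \<open>auto intro: holomorphic_on_imp_continuous_on elim: holomorphic_on_subset\<close>)
  qed
  fix z w :: complex assume "z \<in> unit_disc" "w \<in> unit_disc"
  then have *: "isCont \<psi> z" "isCont \<psi> w"
    using h by (auto intro!: continuous_on_interior[OF holomorphic_on_imp_continuous_on[OF h]]
        simp: interior_open)
  have lim: "((\<lambda>t::real. \<psi> (of_real t * z)) \<longlongrightarrow> \<psi> z) (at_left 1)" if "isCont \<psi> z" for z
  proof (rule isCont_tendsto_compose[OF that])
    show "((\<lambda>t::real. of_real t * z) \<longlongrightarrow> z) (at_left 1)"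
      by (rule tendsto_eq_intros refl | simp)+
  qed
  show "((\<lambda>t. (complex_of_real (B\<^sup>2) - \<psi> (of_real t * z) * cnj (\<psi> (of_real t * w))) * szego z w)
      \<longlongrightarrow> (complex_of_real (B\<^sup>2) - \<psi> z * cnj (\<psi> w)) * szego z w) (at_left 1)"
    by (intro tendsto_intros lim *)
qed simp

lemma bounded_multiplier_szego:
  assumes "\<psi> holomorphic_on unit_disc" "\<And>z. cmod z < 1 \<Longrightarrow> cmod (\<psi> z) \<le> B"
  shows "bounded_multiplier unit_disc szego \<psi>"
  unfolding bounded_multiplier_def
  using pos_kernel_szego_contraction[OF assms] by (intro exI[of _ "B\<^sup>2"]) auto

text \<open>The mixed second difference quotient of the Szego kernel, with h * k cancelled so that
  the left side makes sense at h = k = 0. The variables v and w stand for conjugated points.\<close>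

lemma second_difference_identity:
  fixes h k u v w z :: complex
  defines "A \<equiv> 1 - (z + h) * w" and "B \<equiv> 1 - z * w"
    and "C \<equiv> 1 - (z + h) * v" and "D \<equiv> 1 - z * v"
  assumes "A \<noteq> 0" "B \<noteq> 0" "C \<noteq> 0" "D \<noteq> 0" "h \<noteq> 0" "k \<noteq> 0" "w = v + k"
  shows "(1 - (z + h) * z * v * w) / (A * B * C * D) = (1 / A - 1 / B - 1 / C + 1 / D) / (h * k)"
proof -
  have "1 / A - 1 / B - 1 / C + 1 / D
      = (B * C * D - A * C * D - A * B * D + A * B * C) / (A * B * C * D)"
    using assms(5-8) by (simp add: field_simps)
  also have "B * C * D - A * C * D - A * B * D + A * B * C = (1 - (z + h) * z * v * w) * (h * k)"
    unfolding assms(1-4,11) by algebra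
  finally show ?thesis using assms(9,10) by simp
qed

text \<open>The functionals \<open>f \<mapsto> (f (z + h) - f z) / h\<close> are Cauchy as h tends to 0, because
  their Gram matrix G extends continuously to h = 0.\<close>

lemma rkhs_szego_holomorphic:
  assumes f: "f \<in> rkhs unit_disc szego"
  shows "f holomorphic_on unit_disc"
proof (subst holomorphic_on_open[OF open_unit_disc], intro ballI)
  fix z :: complex assume "z \<in> unit_disc"
  then have z: "cmod z < 1" by simp
  obtain C where C: "C > 0"
    and pos: "pos_kernel unit_disc (\<lambda>z w. complex_of_real C * szego z w - f z * cnj (f w))"
    using rkhsE[OF f pos_kernel_szego] by blast
  define d where "d = (\<lambda>h. (f (z + h) - f z) / h)"
  define G where "G = (\<lambda>h k. (1 - (z + h) * z * cnj z * cnj (z + k)) /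
     ((1 - (z + h) * cnj (z + k)) * (1 - z * cnj (z + k)) * (1 - (z + h) * cnj z) * (1 - z * cnj z)))"
  have bound: "(cmod (d h - d k))\<^sup>2 \<le> C * Re (G h h - G h k - G k h + G k k)"
    if h: "h \<noteq> 0" "cmod (z + h) < 1" and k: "k \<noteq> 0" "cmod (z + k) < 1" for h k
  proof -
    \<comment> \<open>Three points z + h, z + k, z, weighted so that the functional is the
      difference of the two difference quotients.\<close>
    define x where "x = (\<lambda>i::nat. if i = 0 then z + h else if i = 1 then z + k else z)"
    define c where "c = (\<lambda>i::nat. if i = 0 then 1 / h else if i = 1 then - 1 / k else 1 / k - 1 / h)"
    have sums: "(\<Sum>i<3. F i) = F 0 + F 1 + F 2" for F :: "nat \<Rightarrow> complex"
      by (simp add: eval_nat_numeral)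
    have G: "G h k = (szego (z + h) (z + k) - szego z (z + k) - szego (z + h) z + szego z z) / (h * cnj k)"
      if "h \<noteq> 0" "cmod (z + h) < 1" "k \<noteq> 0" "cmod (z + k) < 1" for h k
    proof -
      have "1 - (z + h) * cnj (z + k) \<noteq> 0" "1 - z * cnj (z + k) \<noteq> 0"
        "1 - (z + h) * cnj z \<noteq> 0" "1 - z * cnj z \<noteq> 0"
        using that z by (intro one_minus_mult_cnj_nonzero; simp)+
      moreover have "cnj (z + k) = cnj z + cnj k" "cnj k \<noteq> 0" using that by simp_all
      ultimately show ?thesis using that(1) second_difference_identity[of z h "cnj (z + k)" "cnj z" "cnj k"]
        unfolding G_def szego_def by (simp only: simp_thms)
    qed
    have "(cmod (\<Sum>i<3. c i * f (x i)))\<^sup>2 \<le> C * Re (quad szego 3 x c)"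
      by (rule rkhs_functional_bound[OF pos]) (use h k z in \<open>auto simp: x_def\<close>)
    also have "(\<Sum>i<3. c i * f (x i)) = d h - d k"
      using h(1) k(1) by (simp add: sums x_def c_def d_def field_simps)
    also have "quad szego 3 x c = G h h - G h k - G k h + G k k"
      unfolding G[OF h h] G[OF h k] G[OF k h] G[OF k k] quad_def sums
      using h(1) k(1) by (simp add: x_def c_def divide_simps) algebra
    finally show ?thesis .
  qed
  have nz: "1 - z * cnj z \<noteq> 0" using one_minus_mult_cnj_nonzero[of z z] z by simp
  have Glim: "((\<lambda>p. G (u p) (v p)) \<longlongrightarrow> G 0 0) F"
    if "(u \<longlongrightarrow> 0) F" "(v \<longlongrightarrow> 0) F" for u v and F :: "(complex \<times> complex) filter"
    unfolding G_def
    by (rule tendsto_eq_intros that refl | use nz in simp)+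
  have ev: "eventually (\<lambda>h. h \<noteq> 0 \<and> cmod (z + h) < 1) (at 0)"
  proof -
    have "((\<lambda>h. cmod (z + h)) \<longlongrightarrow> cmod z) (at 0)"
      by (rule tendsto_eq_intros refl | simp)+
    from order_tendstoD(2)[OF this z] show ?thesis
      by (intro eventually_conj eventually_neq_at_within)
  qed
  have "\<exists>L. (d \<longlongrightarrow> L) (at 0)"
  proof -
    have lim1: "(fst \<longlongrightarrow> 0) (at (0::complex) \<times>\<^sub>F at (0::complex))"
      and lim2: "(snd \<longlongrightarrow> 0) (at (0::complex) \<times>\<^sub>F at (0::complex))"
      by (rule filterlim_mono[OF filterlim_fst at_within_le_nhds order_refl],
          rule filterlim_mono[OF filterlim_snd at_within_le_nhds order_refl])
    have "((\<lambda>p. C * Re (G (fst p) (fst p) - G (fst p) (snd p) - G (snd p) (fst p) + G (snd p) (snd p)))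
        \<longlongrightarrow> C * Re (G 0 0 - G 0 0 - G 0 0 + G 0 0)) (at 0 \<times>\<^sub>F at 0)"
      by (intro tendsto_intros Glim lim1 lim2)
    then have lim: "((\<lambda>p. C * Re (G (fst p) (fst p) - G (fst p) (snd p) - G (snd p) (fst p) + G (snd p) (snd p)))
        \<longlongrightarrow> 0) (at 0 \<times>\<^sub>F at 0)" by simp
    have "cauchy_filter (filtermap d (at 0))"
      unfolding cauchy_filter_metric_filtermap
    proof (intro allI impI)
      fix \<epsilon> :: real assume "\<epsilon> > 0"
      then have "eventually (\<lambda>p. C * Re (G (fst p) (fst p) - G (fst p) (snd p) - G (snd p) (fst p)
          + G (snd p) (snd p)) < \<epsilon>\<^sup>2) (at 0 \<times>\<^sub>F at 0)"
        using order_tendstoD(2)[OF lim, of "\<epsilon>\<^sup>2"] by simp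
      then obtain P Q where P: "eventually P (at 0)" and Q: "eventually Q (at 0)"
        and PQ: "\<And>h k. P h \<Longrightarrow> Q k \<Longrightarrow> C * Re (G h h - G h k - G k h + G k k) < \<epsilon>\<^sup>2"
        by (auto simp: eventually_prod_filter)
      show "\<exists>R. eventually R (at 0) \<and> (\<forall>h k. R h \<and> R k \<longrightarrow> dist (d h) (d k) < \<epsilon>)"
      proof (intro exI[of _ "\<lambda>h. P h \<and> Q h \<and> h \<noteq> 0 \<and> cmod (z + h) < 1"] conjI allI impI)
        show "eventually (\<lambda>h. P h \<and> Q h \<and> h \<noteq> 0 \<and> cmod (z + h) < 1) (at 0)"
          using P Q ev by eventually_elim auto
        fix h k assume "(P h \<and> Q h \<and> h \<noteq> 0 \<and> cmod (z + h) < 1) \<and> (P k \<and> Q k \<and> k \<noteq> 0 \<and> cmod (z + k) < 1)"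
        then have "(cmod (d h - d k))\<^sup>2 < \<epsilon>\<^sup>2"
          using bound[of h k] PQ[of h k] by fastforce
        then show "dist (d h) (d k) < \<epsilon>"
          using \<open>\<epsilon> > 0\<close> by (simp add: dist_norm power_less_imp_less_base)
      qed
    qed
    then show ?thesis
      using cauchy_filter_complete_converges[OF _ complete_UNIV, of "filtermap d (at 0)"]
      by (auto simp: filterlim_def filtermap_bot_iff)
  qed
  then show "\<exists>f'. (f has_field_derivative f') (at z)"
    by (auto simp: DERIV_def d_def)
qed

text \<open>The kernel of the Hardy functions vanishing at a is the Szego kernel multiplied by the
  Blaschke factor \<open>(z - a) * szego z a\<close> and its conjugate in w. This is what allows a
  zero to be divided out.\<close>

lemma szego_blaschke_identity:
  assumes "cmod a < 1" "cmod z < 1" "cmod w < 1"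
  shows "szego z w - szego z a * szego a w / szego a a =
     (z - a) * cnj (w - a) * (szego z a * szego a w * szego z w)"
proof -
  have nz: "1 - z * cnj w \<noteq> 0" "1 - z * cnj a \<noteq> 0" "1 - a * cnj w \<noteq> 0" "1 - a * cnj a \<noteq> 0"
    using assms by (intro one_minus_mult_cnj_nonzero; simp)+
  have "szego z w - szego z a * szego a w / szego a a =
      ((1 - z * cnj a) * (1 - a * cnj w) - (1 - a * cnj a) * (1 - z * cnj w)) *
      (szego z a * szego a w * szego z w)"
    using nz unfolding szego_def by (simp add: divide_simps)
  also have "(1 - z * cnj a) * (1 - a * cnj w) - (1 - a * cnj a) * (1 - z * cnj w)
      = (z - a) * cnj (w - a)"
    by (simp add: algebra_simps)
  finally show ?thesis .
qed

text \<open>\<open>(z - a) * q z\<close> vanishes at a, so the Schur complement at a changes only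
  the Szego part of the bounding kernel, which then acquires the factor
  \<open>(z - a) * cnj (w - a)\<close>. Cancelling this factor leaves a bound for q.\<close>

lemma rkhs_szego_divide:
  assumes f: "(\<lambda>z. (z - a) * q z) \<in> rkhs unit_disc szego" and a: "cmod a < 1"
    and q: "continuous_on unit_disc q" and q0: "\<And>z. z \<notin> unit_disc \<Longrightarrow> q z = 0"
  shows "q \<in> rkhs unit_disc szego"
proof -
  obtain C where C: "C > 0" and pos: "pos_kernel unit_disc (\<lambda>z w. complex_of_real C * szego z w
      - ((z - a) * q z) * cnj ((w - a) * q w))"
    using rkhsE[OF f pos_kernel_szego] by blast
  have aa: "szego a a \<noteq> 0"
    using one_minus_mult_cnj_nonzero[of a a] a by (simp add: szego_def)
  have "pos_kernel unit_disc (\<lambda>z w. (complex_of_real C * szego z w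
      - ((z - a) * q z) * cnj ((w - a) * q w))
      - (complex_of_real C * szego z a) * (complex_of_real C * szego a w) / (complex_of_real C * szego a a))"
    using pos_kernel_schur_complement[OF pos, of a] a aa C by simp
  then have p1: "pos_kernel unit_disc (\<lambda>z w. (z - a) * cnj (w - a) *
      (complex_of_real C * (szego z a * cnj (szego w a) * szego z w) - q z * cnj (q w)))"
  proof (rule pos_kernel_cong)
    fix z w assume zw: "z \<in> unit_disc" "w \<in> unit_disc"
    have *: "(complex_of_real C * szego z a) * (complex_of_real C * szego a w) / (complex_of_real C * szego a a)
        = complex_of_real C * (szego z a * szego a w / szego a a)"
      using C by simp
    have **: "cnj (szego w a) = szego a w" by (simp add: szego_def mult.commute)
    have "(z - a) * cnj (w - a) *
      (complex_of_real C * (szego z a * cnj (szego w a) * szego z w) - q z * cnj (q w))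
      = complex_of_real C * ((z - a) * cnj (w - a) * (szego z a * szego a w * szego z w))
        - ((z - a) * q z) * cnj ((w - a) * q w)"
      unfolding ** by (simp add: algebra_simps)
    also have "\<dots> = (complex_of_real C * szego z w - ((z - a) * q z) * cnj ((w - a) * q w))
      - (complex_of_real C * szego z a) * (complex_of_real C * szego a w) / (complex_of_real C * szego a a)"
    proof -
      have "(z - a) * cnj (w - a) * (szego z a * szego a w * szego z w) =
          szego z w - szego z a * szego a w / szego a a"
        using szego_blaschke_identity[OF a, of z w] zw by simp
      moreover have "c * (s - t) - b = (c * s - b) - c * t" for b c s t :: complex
        by (simp add: algebra_simps)
      ultimately show ?thesis unfolding * by simp
    qed
    finally show "(z - a) * cnj (w - a) *
      (complex_of_real C * (szego z a * cnj (szego w a) * szego z w) - q z * cnj (q w)) = \<dots>" .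
  qed
  let ?L = "\<lambda>z w. complex_of_real C * (szego z a * cnj (szego w a) * szego z w) - q z * cnj (q w)"
  have p2: "pos_kernel (unit_disc - {a}) ?L"
  proof (rule pos_kernel_cong[OF pos_kernel_congruence[where f = "\<lambda>z. 1 / (z - a)"]])
    show "pos_kernel (unit_disc - {a}) (\<lambda>z w. (z - a) * cnj (w - a) * ?L z w)"
      using p1 by (auto simp: pos_kernel_iff)
  qed auto
  have sc: "isCont (\<lambda>z. szego z a) z" if "cmod z < 1" for z
    unfolding szego_def using one_minus_mult_cnj_nonzero[of z a] that a by (intro continuous_intros) auto
  have qc: "isCont q z" if "cmod z < 1" for z
    using continuous_on_interior[OF q] that by (simp add: interior_open)
  text \<open>Positivity at a itself is obtained by moving all the points slightly.\<close>
  have p3: "pos_kernel unit_disc ?L"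
  proof (rule pos_kernelI)
    fix n and x :: "nat \<Rightarrow> complex" and c
    assume "\<And>i. i < n \<Longrightarrow> x i \<in> unit_disc"
    then have x: "\<And>i. i < n \<Longrightarrow> cmod (x i) < 1" by simp
    have lim: "((\<lambda>e. x i + e) \<longlongrightarrow> x i) (at 0)" for i
      by (rule tendsto_eq_intros refl | simp)+
    have ev: "eventually (\<lambda>e. \<forall>i\<in>{..<n}. x i + e \<in> unit_disc - {a}) (at 0)"
    proof (intro eventually_ball_finite ballI finite_lessThan)
      fix i assume "i \<in> {..<n}"
      then have "eventually (\<lambda>e. cmod (x i + e) < 1) (at 0)"
        using order_tendstoD(2)[OF tendsto_norm[OF lim[of i]]] x by simp
      moreover have "eventually (\<lambda>e. e \<noteq> a - x i) (at 0)"
        by (rule eventually_neq_at_within)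
      ultimately show "eventually (\<lambda>e. x i + e \<in> unit_disc - {a}) (at 0)"
        by eventually_elim (auto simp: algebra_simps)
    qed
    have "((\<lambda>e. quad ?L n (\<lambda>i. x i + e) c) \<longlongrightarrow> quad ?L n x c) (at 0)"
      unfolding quad_def szego_def[of "x i + e" "x j + e" for i j e] szego_def[of "x i" "x j" for i j]
      by (intro tendsto_intros lim isCont_tendsto_compose[OF sc lim] isCont_tendsto_compose[OF qc lim])
        (use x one_minus_mult_cnj_nonzero in \<open>auto simp: less_imp_le\<close>)
    moreover have "eventually (\<lambda>e. quad ?L n (\<lambda>i. x i + e) c \<in> \<real>\<^sub>\<ge>\<^sub>0) (at 0)"
      using ev by eventually_elim (auto intro!: pos_kernelD[OF p2])
    ultimately show "quad ?L n x c \<in> \<real>\<^sub>\<ge>\<^sub>0"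
      by (intro Lim_in_closed_set[OF closed_nonneg_Reals_complex _ at_neq_bot])
  qed
  \<comment> \<open>The remaining factor \<open>szego z a\<close> is bounded on the disc, hence a
    multiplier of the Hardy space, and can be absorbed into the constant.\<close>
  obtain B where B: "B \<ge> 0" "pos_kernel unit_disc (\<lambda>z w. (complex_of_real B - szego z a * cnj (szego w a)) * szego z w)"
  proof -
    have "compact ((\<lambda>z. szego z a) ` cball 0 1)"
      by (intro compact_continuous_image continuous_on_szego a) auto
    then obtain b where "\<forall>z\<in>cball 0 1. cmod (szego z a) \<le> b"
      by (auto simp: bounded_iff dest!: compact_imp_bounded)
    then have "\<And>z. cmod z < 1 \<Longrightarrow> cmod (szego z a) \<le> b" by simp
    then show ?thesis
      using bounded_multiplier_szego[of "\<lambda>z. szego z a" b] holomorphic_on_szego[OF a] that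
      by (auto simp: bounded_multiplier_def unit_disc_eq)
  qed
  have "pos_kernel unit_disc (\<lambda>z w. complex_of_real (C * B) * szego z w - q z * cnj (q w))"
    using C by (intro pos_kernel_cong[OF pos_kernel_add[OF p3 pos_kernel_scale[OF B(2), of C]]])
      (simp_all add: algebra_simps)
  then show ?thesis using B C q0 by (intro rkhsI[of _ _ "C * B"]) auto
qed

section \<open>The kernel of a disc with one self-crossing\<close>

lemma bounded_multiplier_cong:
  assumes "bounded_multiplier S K \<phi>" "\<And>z. z \<in> S \<Longrightarrow> \<psi> z = \<phi> z"
  shows "bounded_multiplier S K \<psi>"
proof -
  obtain C where C: "C \<ge> 0" "pos_kernel S (\<lambda>z w. (complex_of_real C - \<phi> z * cnj (\<phi> w)) * K z w)"
    using assms(1) by (auto simp: bounded_multiplier_def)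
  have "pos_kernel S (\<lambda>z w. (complex_of_real C - \<psi> z * cnj (\<psi> w)) * K z w)"
    by (rule pos_kernel_cong[OF C(2)]) (simp add: assms(2))
  with C(1) show ?thesis by (auto simp: bounded_multiplier_def)
qed

text \<open>The elements of mult_alg vanish off the disc.\<close>

definition cut :: "(complex \<Rightarrow> complex) \<Rightarrow> complex \<Rightarrow> complex" where
  "cut f z = (if z \<in> unit_disc then f z else 0)"

lemma cut_in [simp]: "cmod z < 1 \<Longrightarrow> cut f z = f z"
  by (simp add: cut_def)

lemma cut_multipliers: "bounded_multiplier unit_disc K \<phi> \<Longrightarrow> cut \<phi> \<in> multipliers unit_disc K"
  by (rule multipliersI) (auto simp: cut_def elim: bounded_multiplier_cong)

lemma one_minus_of_real_mult_nonzero: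
  assumes "\<bar>r\<bar> < 1" "cmod z \<le> 1"
  shows "1 - complex_of_real r * z \<noteq> 0"
  using one_minus_mult_cnj_nonzero(2)[of z "complex_of_real r"] assms by simp

lemma blaschke_eq_Moebius: "blaschke r z = Moebius_function 0 (complex_of_real r) z"
  by (simp add: blaschke_def Moebius_function_simple)

lemma norm_blaschke_less_one: "\<bar>r\<bar> < 1 \<Longrightarrow> cmod z < 1 \<Longrightarrow> cmod (blaschke r z) < 1"
  unfolding blaschke_eq_Moebius by (rule Moebius_function_norm_lt_1) auto

lemma blaschke_kernel_identity:
  assumes "\<bar>r\<bar> < 1" "cmod z < 1" "cmod w < 1"
  shows "1 - blaschke r z * cnj (blaschke r w) =
    (1 - (complex_of_real r)\<^sup>2) * (1 - z * cnj w) /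
    ((1 - complex_of_real r * z) * cnj (1 - complex_of_real r * w))"
proof -
  define d where "d = (1 - complex_of_real r * z) * (1 - complex_of_real r * cnj w)"
  have nz: "1 - complex_of_real r * z \<noteq> 0" "1 - complex_of_real r * cnj w \<noteq> 0"
    using one_minus_of_real_mult_nonzero assms by auto
  have "blaschke r z * cnj (blaschke r w) = (z - complex_of_real r) * (cnj w - complex_of_real r) / d"
    by (simp add: blaschke_def d_def)
  then have "1 - blaschke r z * cnj (blaschke r w)
      = (d - (z - complex_of_real r) * (cnj w - complex_of_real r)) / d"
    using nz by (simp only: diff_divide_distrib) (simp add: d_def)
  also have "d - (z - complex_of_real r) * (cnj w - complex_of_real r)
      = (1 - (complex_of_real r)\<^sup>2) * (1 - z * cnj w)"
    unfolding d_def by algebra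
  finally show ?thesis by (simp add: d_def)
qed

locale crossing_disc =
  fixes r :: real
  assumes r_gt: "-1 < r" and r_less: "r < 0"
begin

abbreviation "\<rho> \<equiv> complex_of_real r"
abbreviation "K \<equiv> kernel_h (f_map r)"
abbreviation "H \<equiv> rkhs unit_disc K"
abbreviation "M \<equiv> mult_alg (f_map r)"

abbreviation "x \<equiv> blaschke r"
abbreviation "y \<equiv> blaschke (- r)"
definition "X z = (x z)\<^sup>2"
definition "Y z = (y z)\<^sup>2"
definition "g z = (X z + Y z) / 2"
definition "m z = (1 - X z) * (1 - Y z)"

section \<open>Bounds for the coordinates and positivity of the kernel\<close>

lemma abs_r: "\<bar>r\<bar> < 1" and abs_neg_r: "\<bar>- r\<bar> < 1"
  using r_gt r_less by auto

lemma denominator_nonzero: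
  assumes "cmod z \<le> 1"
  shows "1 - \<rho> * z \<noteq> 0" "1 + \<rho> * z \<noteq> 0"
  using one_minus_of_real_mult_nonzero[OF abs_r assms] one_minus_of_real_mult_nonzero[OF abs_neg_r assms]
  by auto

lemma x_def': "x z = (z - \<rho>) / (1 - \<rho> * z)" and y_def': "y z = (z + \<rho>) / (1 + \<rho> * z)"
  by (simp_all add: blaschke_def)

lemma norm_x: "cmod z < 1 \<Longrightarrow> cmod (x z) < 1" and norm_y: "cmod z < 1 \<Longrightarrow> cmod (y z) < 1"
  using norm_blaschke_less_one abs_r abs_neg_r by auto

lemma norm_X: "cmod z < 1 \<Longrightarrow> cmod (X z) < 1" and norm_Y: "cmod z < 1 \<Longrightarrow> cmod (Y z) < 1"
  by (simp_all add: X_def Y_def norm_power norm_x norm_y power_less_one_iff)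

lemma norm_g: "cmod z < 1 \<Longrightarrow> cmod (g z) < 1"
  using norm_triangle_ineq[of "X z" "Y z"] norm_X[of z] norm_Y[of z]
  by (simp add: g_def norm_divide)

lemma holomorphic_X: "X holomorphic_on cball 0 1" and holomorphic_Y: "Y holomorphic_on cball 0 1"
  unfolding X_def Y_def x_def' y_def'
  by (intro holomorphic_intros; use denominator_nonzero in force)+

lemma holomorphic_g: "g holomorphic_on cball 0 1"
  unfolding g_def by (auto intro!: holomorphic_intros holomorphic_X holomorphic_Y)

lemma K_eq: "K z w = 1 / (1 - (X z * cnj (X w) + Y z * cnj (Y w)) / 2)"
proof -
  have "complex_of_real (sqrt 2) * complex_of_real (sqrt 2) = 2"
    by (metis of_real_mult real_sqrt_mult_self of_real_numeral abs_numeral)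
  then show ?thesis
    by (simp add: kernel_h_def inner2_def f_map_def X_def Y_def add_divide_distrib)
qed

lemma norm_inner:
  assumes "cmod z < 1" "cmod w < 1"
  shows "cmod ((X z * cnj (X w) + Y z * cnj (Y w)) / 2) < 1"
proof -
  have "cmod (X z * cnj (X w)) < 1" "cmod (Y z * cnj (Y w)) < 1"
    using assms by (auto intro!: norm_mult_cnj_less_one norm_X norm_Y)
  then have "cmod (X z * cnj (X w) + Y z * cnj (Y w)) < 2"
    using norm_triangle_ineq[of "X z * cnj (X w)" "Y z * cnj (Y w)"] by linarith
  then show ?thesis by (simp only: norm_divide norm_numeral)
qed

lemma K_denominator_nonzero:
  assumes "cmod z < 1" "cmod w < 1"
  shows "1 - (X z * cnj (X w) + Y z * cnj (Y w)) / 2 \<noteq> 0"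
  using norm_inner[OF assms] by (metis eq_iff_diff_eq_0 norm_one less_irrefl)

lemma pos_kernel_mult_K:
  assumes "pos_kernel unit_disc P"
  shows "pos_kernel unit_disc (\<lambda>z w. P z w * K z w)"
proof (rule pos_kernel_cong[OF pos_kernel_geometric[OF assms]])
  show "pos_kernel unit_disc (\<lambda>z w. ((X z * cnj (X w) + Y z * cnj (Y w)) / 2) * Q z w)"
    if "pos_kernel unit_disc Q" for Q
    by (rule pos_kernel_cong[OF pos_kernel_scale[OF pos_kernel_add[OF
        pos_kernel_congruence[OF that, of X] pos_kernel_congruence[OF that, of Y]], of "1/2"]])
      (auto simp: algebra_simps)
qed (use norm_inner in \<open>auto simp: K_eq simp del: norm_divide\<close>)

lemma pos_kernel_K: "pos_kernel unit_disc K"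
  using pos_kernel_mult_K[OF pos_kernel_one] by simp

lemma K_expand:
  assumes "cmod z < 1" "cmod w < 1"
  shows "K z w = 1 + (X z * cnj (X w) + Y z * cnj (Y w)) / 2 * K z w"
proof -
  have "1 / (1 - u) = 1 + u * (1 / (1 - u))" if "1 - u \<noteq> 0" for u :: complex
    using that by (simp add: field_simps)
  from this[OF K_denominator_nonzero[OF assms]] show ?thesis unfolding K_eq .
qed

lemma K_expand2:
  assumes "cmod z < 1" "cmod w < 1"
  shows "2 * K z w = 2 + (X z * cnj (X w) + Y z * cnj (Y w)) * K z w"
  using arg_cong[OF K_expand[OF assms], of "\<lambda>k. 2 * k"] by simp

lemma one_mem_H: "cut (\<lambda>_. 1) \<in> H"
proof (rule rkhsI[of _ _ 1])
  have e: "K z w - 1 = of_real (1/2) * (X z * cnj (X w) * K z w + Y z * cnj (Y w) * K z w)"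
    if "cmod z < 1" "cmod w < 1" for z w
    using K_expand2[OF that] by (simp add: field_simps)
  show "pos_kernel unit_disc (\<lambda>z w. complex_of_real 1 * K z w - cut (\<lambda>_. 1) z * cnj (cut (\<lambda>_. 1) w))"
    by (rule pos_kernel_cong[OF pos_kernel_scale[OF pos_kernel_add[OF
        pos_kernel_congruence[OF pos_kernel_K, of X] pos_kernel_congruence[OF pos_kernel_K, of Y]], of "1/2"]])
      (use e in simp_all)
qed (auto simp: cut_def)

text \<open>X and Y are sqrt 2 times the coordinates of the map into the ball. Moving one of the two
  terms of \<open>K_expand2\<close> to the other side leaves a visibly positive kernel.\<close>

lemma bounded_multiplier_X: "bounded_multiplier unit_disc K X"
  and bounded_multiplier_Y: "bounded_multiplier unit_disc K Y"
proof -
  have e: "(2 - X z * cnj (X w)) * K z w = 2 + Y z * cnj (Y w) * K z w"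
    "(2 - Y z * cnj (Y w)) * K z w = 2 + X z * cnj (X w) * K z w"
    if "cmod z < 1" "cmod w < 1" for z w
    using K_expand2[OF that] by algebra+
  have "pos_kernel unit_disc (\<lambda>z w. (complex_of_real 2 - X z * cnj (X w)) * K z w)"
    by (rule pos_kernel_cong[OF pos_kernel_add[OF pos_kernel_scale[OF pos_kernel_one, of 2]
        pos_kernel_congruence[OF pos_kernel_K, of Y]]])
      (use e in simp_all)
  then show "bounded_multiplier unit_disc K X" by (auto simp: bounded_multiplier_def intro: exI[of _ 2])
  have "pos_kernel unit_disc (\<lambda>z w. (complex_of_real 2 - Y z * cnj (Y w)) * K z w)"
    by (rule pos_kernel_cong[OF pos_kernel_add[OF pos_kernel_scale[OF pos_kernel_one, of 2]
        pos_kernel_congruence[OF pos_kernel_K, of X]]])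
      (use e in simp_all)
  then show "bounded_multiplier unit_disc K Y" by (auto simp: bounded_multiplier_def intro: exI[of _ 2])
qed

lemmas bounded_multiplier_intros =
  bounded_multiplier_X bounded_multiplier_Y bounded_multiplier_mult
  bounded_multiplier_add[OF pos_kernel_K] bounded_multiplier_const[OF pos_kernel_K]

definition q :: "nat \<Rightarrow> complex \<Rightarrow> complex" where
  "q i z = [1 / (1 - \<rho> * z), x z / (1 - \<rho> * z), 1 / (1 + \<rho> * z), y z / (1 + \<rho> * z)] ! i"

lemma sum4: "(\<Sum>i<4. F i) = F 0 + F 1 + F 2 + F (3::nat)" for F :: "nat \<Rightarrow> complex"
  by (simp add: eval_nat_numeral)

lemma q_simps:
  "q 0 z = 1 / (1 - \<rho> * z)" "q (Suc 0) z = x z / (1 - \<rho> * z)"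
  "q 2 z = 1 / (1 + \<rho> * z)" "q 3 z = y z / (1 + \<rho> * z)"
  by (simp_all add: q_def)

definition "\<kappa> = (1 - r\<^sup>2) / 2"

lemma \<kappa>_pos: "\<kappa> > 0"
  using abs_r by (simp add: \<kappa>_def abs_square_less_1)

lemma szego_eq:
  assumes "cmod z < 1" "cmod w < 1"
  shows "szego z w = of_real \<kappa> * (\<Sum>i<4. q i z * cnj (q i w)) * K z w"
proof -
  define A where "A = 1 / ((1 - \<rho> * z) * cnj (1 - \<rho> * w))"
  define B where "B = 1 / ((1 + \<rho> * z) * cnj (1 + \<rho> * w))"
  define p where "p = x z * cnj (x w)"
  define p' where "p' = y z * cnj (y w)"
  have p: "1 - p = (1 - \<rho>\<^sup>2) * (1 - z * cnj w) * A"
    using blaschke_kernel_identity[OF abs_r assms] by (simp add: p_def A_def)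
  have p': "1 - p' = (1 - \<rho>\<^sup>2) * (1 - z * cnj w) * B"
    using blaschke_kernel_identity[OF abs_neg_r assms] by (simp add: p'_def B_def)
  have "(\<Sum>i<4. q i z * cnj (q i w)) = (1 + p) * A + (1 + p') * B"
  proof -
    have "q 0 z * cnj (q 0 w) = A" "q (Suc 0) z * cnj (q (Suc 0) w) = p * A"
      "q 2 z * cnj (q 2 w) = B" "q 3 z * cnj (q 3 w) = p' * B"
      by (simp_all add: q_simps A_def B_def p_def p'_def)
    then show ?thesis by (simp add: sum4 algebra_simps)
  qed
  moreover have "1 - (X z * cnj (X w) + Y z * cnj (Y w)) / 2
      = ((1 + p) * (1 - p) + (1 + p') * (1 - p')) / 2"
    by (simp add: X_def Y_def p_def p'_def field_simps power2_eq_square)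
  then have e: "1 - (X z * cnj (X w) + Y z * cnj (Y w)) / 2
      = (1 - \<rho>\<^sup>2) / 2 * ((1 + p) * A + (1 + p') * B) * (1 - z * cnj w)"
    unfolding p p' by (simp add: algebra_simps)
  moreover have "1 - z * cnj w \<noteq> 0" using one_minus_mult_cnj_nonzero[of z w] assms by simp
  moreover have "(1 - \<rho>\<^sup>2) / 2 * ((1 + p) * A + (1 + p') * B) * (1 - z * cnj w) \<noteq> 0"
    using K_denominator_nonzero[OF assms] unfolding e .
  ultimately show ?thesis
    unfolding szego_def K_eq \<kappa>_def by (simp add: e)
qed

lemma szego_dominates_K:
  obtains C where "C \<ge> 0" "pos_kernel unit_disc (\<lambda>z w. complex_of_real C * szego z w - K z w)"
proof
  have p: "pos_kernel unit_disc (\<lambda>z w. q i z * cnj (q i w) * K z w)" for i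
    by (rule pos_kernel_congruence[OF pos_kernel_K])
  have 1: "pos_kernel unit_disc (\<lambda>z w. szego z w - of_real \<kappa> * (q 0 z * cnj (q 0 w) * K z w))"
    by (rule pos_kernel_cong[OF pos_kernel_scale[OF pos_kernel_add[OF pos_kernel_add[OF p[of 1] p[of 2]] p[of 3]],
        of \<kappa>]])
      (use \<kappa>_pos in \<open>auto simp: szego_eq sum4 algebra_simps\<close>)
  have 2: "pos_kernel unit_disc (\<lambda>z w. (complex_of_real (2\<^sup>2) - (1 - \<rho> * z) * cnj (1 - \<rho> * w)) * szego z w)"
  proof (rule pos_kernel_szego_contraction)
    fix z assume "cmod z < 1"
    then have "cmod (\<rho> * z) \<le> 1"
      using abs_r mult_mono[of "\<bar>r\<bar>" 1 "cmod z" 1] by (simp add: norm_mult)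
    then show "cmod (1 - \<rho> * z) \<le> 2"
      using norm_triangle_ineq4[of 1 "\<rho> * z"] by simp
  qed (auto intro!: holomorphic_intros)
  show "pos_kernel unit_disc (\<lambda>z w. complex_of_real (4 / \<kappa>) * szego z w - K z w)"
  proof (rule pos_kernel_cong[OF pos_kernel_scale[OF pos_kernel_add[OF 2
        pos_kernel_congruence[OF 1, of "\<lambda>z. 1 - \<rho> * z"]], of "1 / \<kappa>"]])
    fix z w assume zw: "z \<in> unit_disc" "w \<in> unit_disc"
    define e where "e = (1 - \<rho> * z) * cnj (1 - \<rho> * w)"
    have e: "e \<noteq> 0" using zw denominator_nonzero by (simp add: e_def flip: complex_cnj_diff)
    have q0: "q 0 z * cnj (q 0 w) = 1 / e" by (simp add: q_simps e_def)
    show "complex_of_real (4 / \<kappa>) * szego z w - K z w = complex_of_real (1 / \<kappa>) *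
        ((complex_of_real (2\<^sup>2) - (1 - \<rho> * z) * cnj (1 - \<rho> * w)) * szego z w +
         (1 - \<rho> * z) * cnj (1 - \<rho> * w) * (szego z w - of_real \<kappa> * (q 0 z * cnj (q 0 w) * K z w)))"
      unfolding q0 e_def[symmetric] using e \<kappa>_pos by (simp add: field_simps)
  qed (use \<kappa>_pos in auto)
qed (use \<kappa>_pos in auto)

text \<open>This puts \<open>x * (1 - Y)\<close> and \<open>y * (1 - X)\<close> into
  the algebra generated by X and Y.\<close>

lemma x_eliminate:
  assumes "cmod z < 1"
  shows "x z * (1 - Y z) = ((1 + \<rho>\<^sup>2)\<^sup>2 * Y z + 4 * \<rho>\<^sup>2 * (X z * Y z) - (1 + \<rho>\<^sup>2)\<^sup>2 * X z - 4 * \<rho>\<^sup>2)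
      / (4 * \<rho> * (1 + \<rho>\<^sup>2))"
    and "y z * (1 - X z) = ((1 + \<rho>\<^sup>2)\<^sup>2 * X z + 4 * \<rho>\<^sup>2 * (X z * Y z) - (1 + \<rho>\<^sup>2)\<^sup>2 * Y z - 4 * \<rho>\<^sup>2)
      / (- 4 * \<rho> * (1 + \<rho>\<^sup>2))"
proof -
  have nz: "1 - \<rho> * z \<noteq> 0" "1 + \<rho> * z \<noteq> 0" using denominator_nonzero assms by auto
  have pn: "1 + \<rho>\<^sup>2 \<noteq> 0" "\<rho> \<noteq> 0"
  proof -
    have "1 + r\<^sup>2 \<noteq> 0" by (smt (verit) zero_le_power2)
    then show "1 + \<rho>\<^sup>2 \<noteq> 0" by (metis of_real_1 of_real_add of_real_eq_0_iff of_real_power)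
  qed (use r_less in auto)
  have x: "x z * (1 - \<rho> * z) = z - \<rho>" and y: "y z * (1 + \<rho> * z) = z + \<rho>"
    using nz by (simp_all add: x_def' y_def')
  \<comment> \<open>y is a Moebius transform of x. Squaring this relation gives an equation between
    X, Y and x that is linear in x, with coefficient a constant times 1 - Y; solving for x gives the
    first formula. Eliminating x instead gives the second.\<close>
  have xy: "y z * ((1 + \<rho>\<^sup>2) + 2 * \<rho> * x z) = (1 + \<rho>\<^sup>2) * x z + 2 * \<rho>"
  proof -
    have "(y z * ((1 + \<rho>\<^sup>2) + 2 * \<rho> * x z)) * ((1 - \<rho> * z) * (1 + \<rho> * z))
        = ((1 + \<rho>\<^sup>2) * x z + 2 * \<rho>) * ((1 - \<rho> * z) * (1 + \<rho> * z))"
      using x y by algebra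
    then show ?thesis using nz by simp
  qed
  have a: "x z * (1 - Y z) * (4 * \<rho> * (1 + \<rho>\<^sup>2)) =
    (1 + \<rho>\<^sup>2)\<^sup>2 * Y z + 4 * \<rho>\<^sup>2 * (X z * Y z) - (1 + \<rho>\<^sup>2)\<^sup>2 * X z - 4 * \<rho>\<^sup>2"
    unfolding X_def Y_def using xy by algebra
  have b: "y z * (1 - X z) * (- 4 * \<rho> * (1 + \<rho>\<^sup>2)) =
    (1 + \<rho>\<^sup>2)\<^sup>2 * X z + 4 * \<rho>\<^sup>2 * (X z * Y z) - (1 + \<rho>\<^sup>2)\<^sup>2 * Y z - 4 * \<rho>\<^sup>2"
    unfolding X_def Y_def using xy by algebra
  show "x z * (1 - Y z) = ((1 + \<rho>\<^sup>2)\<^sup>2 * Y z + 4 * \<rho>\<^sup>2 * (X z * Y z) - (1 + \<rho>\<^sup>2)\<^sup>2 * X z - 4 * \<rho>\<^sup>2)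
      / (4 * \<rho> * (1 + \<rho>\<^sup>2))"
    unfolding a[symmetric] using pn by simp
  show "y z * (1 - X z) = ((1 + \<rho>\<^sup>2)\<^sup>2 * X z + 4 * \<rho>\<^sup>2 * (X z * Y z) - (1 + \<rho>\<^sup>2)\<^sup>2 * Y z - 4 * \<rho>\<^sup>2)
      / (- 4 * \<rho> * (1 + \<rho>\<^sup>2))"
    unfolding b[symmetric] using pn by simp
qed

lemma bounded_multiplier_diff:
  assumes "bounded_multiplier unit_disc K \<phi>" "bounded_multiplier unit_disc K \<psi>"
  shows "bounded_multiplier unit_disc K (\<lambda>z. \<phi> z - \<psi> z)"
  using bounded_multiplier_add[OF pos_kernel_K assms(1)
      bounded_multiplier_mult[OF bounded_multiplier_const[OF pos_kernel_K, of "-1"] assms(2)]]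
  by simp

lemma bounded_multiplier_divide:
  assumes "bounded_multiplier unit_disc K \<phi>"
  shows "bounded_multiplier unit_disc K (\<lambda>z. \<phi> z / a)"
  using bounded_multiplier_mult[OF bounded_multiplier_const[OF pos_kernel_K, of "1 / a"] assms]
  by simp

text \<open>\<open>q 0\<close> and \<open>q 1\<close> are combinations of 1, x and X, and
  \<open>q 2\<close>, \<open>q 3\<close> of 1, y and Y. The factor m supplies 1 - Y next to x and 1
  - X next to y, which is what \<open>x_eliminate\<close> requires. Together with
  \<open>szego_eq\<close> this bounds the congruence of the Szego kernel by m.\<close>

lemma bounded_multiplier_m_q:
  assumes "i < 4"
  shows "bounded_multiplier unit_disc K (\<lambda>z. m z * q i z)"
proof -
  note intros = bounded_multiplier_const[OF pos_kernel_K] bounded_multiplier_intros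
    bounded_multiplier_diff bounded_multiplier_divide
  have xY: "bounded_multiplier unit_disc K (\<lambda>z. x z * (1 - Y z))"
  proof (rule bounded_multiplier_cong)
    show "bounded_multiplier unit_disc K (\<lambda>z. ((1 + \<rho>\<^sup>2)\<^sup>2 * Y z + 4 * \<rho>\<^sup>2 * (X z * Y z)
        - (1 + \<rho>\<^sup>2)\<^sup>2 * X z - 4 * \<rho>\<^sup>2) / (4 * \<rho> * (1 + \<rho>\<^sup>2)))"
      by (intro intros)
  qed (simp add: x_eliminate(1))
  have yX: "bounded_multiplier unit_disc K (\<lambda>z. y z * (1 - X z))"
  proof (rule bounded_multiplier_cong)
    show "bounded_multiplier unit_disc K (\<lambda>z. ((1 + \<rho>\<^sup>2)\<^sup>2 * X z + 4 * \<rho>\<^sup>2 * (X z * Y z)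
        - (1 + \<rho>\<^sup>2)\<^sup>2 * Y z - 4 * \<rho>\<^sup>2) / (- 4 * \<rho> * (1 + \<rho>\<^sup>2)))"
      by (intro intros)
  qed (simp add: x_eliminate(2))
  have r2: "1 - \<rho>\<^sup>2 \<noteq> 0"
  proof -
    have "1 - \<rho>\<^sup>2 = complex_of_real (2 * \<kappa>)" by (simp add: \<kappa>_def)
    then show ?thesis using \<kappa>_pos by simp
  qed
  have q0: "q 0 z = (1 + \<rho> * x z) / (1 - \<rho>\<^sup>2)" and q2: "q 2 z = (1 - \<rho> * y z) / (1 - \<rho>\<^sup>2)"
    if "cmod z < 1" for z
  proof -
    have nz: "1 - \<rho> * z \<noteq> 0" "1 + \<rho> * z \<noteq> 0" using denominator_nonzero that by auto
    then have "x z * (1 - \<rho> * z) = z - \<rho>" "y z * (1 + \<rho> * z) = z + \<rho>"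
      by (simp_all add: x_def' y_def')
    then have "1 * (1 - \<rho>\<^sup>2) = (1 + \<rho> * x z) * (1 - \<rho> * z)"
      "1 * (1 - \<rho>\<^sup>2) = (1 - \<rho> * y z) * (1 + \<rho> * z)" by algebra+
    then show "q 0 z = (1 + \<rho> * x z) / (1 - \<rho>\<^sup>2)" "q 2 z = (1 - \<rho> * y z) / (1 - \<rho>\<^sup>2)"
      unfolding q_simps by (simp_all only: frac_eq_eq[OF nz(1) r2] frac_eq_eq[OF nz(2) r2])
  qed
  have q1: "q 1 z = x z * q 0 z" and q3: "q 3 z = y z * q 2 z" for z
    by (simp_all add: q_simps)
  consider "i = 0" | "i = 1" | "i = 2" | "i = 3" using assms by linarith
  then show ?thesis
  proof cases
    case 1
    have "bounded_multiplier unit_disc K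
        (\<lambda>z. (1 - X z) * ((1 - Y z) + \<rho> * (x z * (1 - Y z))) / (1 - \<rho>\<^sup>2))"
      by (intro intros xY)
    then show ?thesis
      by (rule bounded_multiplier_cong) (simp add: 1 q0 m_def add_divide_distrib diff_divide_distrib algebra_simps)
  next
    case 2
    have "bounded_multiplier unit_disc K
        (\<lambda>z. (1 - X z) * (x z * (1 - Y z) + \<rho> * X z * (1 - Y z)) / (1 - \<rho>\<^sup>2))"
      by (intro intros xY)
    then show ?thesis
      by (rule bounded_multiplier_cong) (simp add: 2 q0 q1[simplified] m_def X_def power2_eq_square
          add_divide_distrib diff_divide_distrib algebra_simps)
  next
    case 3
    have "bounded_multiplier unit_disc K
        (\<lambda>z. (1 - Y z) * ((1 - X z) - \<rho> * (y z * (1 - X z))) / (1 - \<rho>\<^sup>2))"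
      by (intro intros yX)
    then show ?thesis
      by (rule bounded_multiplier_cong) (simp add: 3 q2 m_def add_divide_distrib diff_divide_distrib algebra_simps)
  next
    case 4
    have "bounded_multiplier unit_disc K
        (\<lambda>z. (1 - Y z) * (y z * (1 - X z) - \<rho> * Y z * (1 - X z)) / (1 - \<rho>\<^sup>2))"
      by (intro intros yX)
    then show ?thesis
      by (rule bounded_multiplier_cong) (simp add: 4 q2 q3 m_def Y_def power2_eq_square
          add_divide_distrib diff_divide_distrib algebra_simps)
  qed
qed

lemma K_dominates_m_szego:
  obtains C where "C \<ge> 0"
    "pos_kernel unit_disc (\<lambda>z w. complex_of_real C * K z w - m z * cnj (m w) * szego z w)"
proof -
  have "\<forall>i. \<exists>C. i < 4 \<longrightarrow> C \<ge> 0 \<and> pos_kernel unit_disc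
      (\<lambda>z w. (complex_of_real C - (m z * q i z) * cnj (m w * q i w)) * K z w)"
    using bounded_multiplier_m_q unfolding bounded_multiplier_def by blast
  from choice[OF this] obtain C where C: "\<And>i. i < 4 \<Longrightarrow> C i \<ge> 0"
    "\<And>i. i < (4::nat) \<Longrightarrow> pos_kernel unit_disc
      (\<lambda>z w. (complex_of_real (C i) - (m z * q i z) * cnj (m w * q i w)) * K z w)"
    by blast
  show thesis
  proof (rule that[of "\<kappa> * (C 0 + C 1 + C 2 + C 3)"])
    show "pos_kernel unit_disc (\<lambda>z w. complex_of_real (\<kappa> * (C 0 + C 1 + C 2 + C 3)) * K z w
        - m z * cnj (m w) * szego z w)"
      by (rule pos_kernel_cong[OF pos_kernel_scale[OF pos_kernel_add[OF pos_kernel_add[OF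
          C(2)[of 0] C(2)[of 1]] pos_kernel_add[OF C(2)[of 2] C(2)[of 3]]], of \<kappa>]])
        (use \<kappa>_pos in \<open>auto simp: szego_eq sum4 algebra_simps\<close>)
  qed (use C(1) \<kappa>_pos in auto)
qed

text \<open>Multiplication by m * \<psi> factors through the Hardy space: include H there, multiply
  by \<psi>, return by m. The constant is the product of the three bounds.\<close>

lemma bounded_multiplier_m_mult:
  assumes "\<psi> holomorphic_on unit_disc" "\<And>z. cmod z < 1 \<Longrightarrow> cmod (\<psi> z) \<le> B"
  shows "bounded_multiplier unit_disc K (\<lambda>z. m z * \<psi> z)"
proof -
  obtain A where A: "A \<ge> 0" "pos_kernel unit_disc (\<lambda>z w. complex_of_real A * szego z w - K z w)"
    using szego_dominates_K by blast
  obtain C where C: "C \<ge> 0"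
    "pos_kernel unit_disc (\<lambda>z w. complex_of_real C * K z w - m z * cnj (m w) * szego z w)"
    using K_dominates_m_szego by blast
  note V = pos_kernel_szego_contraction[OF assms]
  have "pos_kernel unit_disc (\<lambda>z w. (complex_of_real (A * B\<^sup>2 * C)
      - (m z * \<psi> z) * cnj (m w * \<psi> w)) * K z w)"
    by (rule pos_kernel_cong[OF pos_kernel_add[OF pos_kernel_congruence[OF A(2), of "\<lambda>z. m z * \<psi> z"]
        pos_kernel_add[OF pos_kernel_scale[OF pos_kernel_congruence[OF V, of m] A(1)]
          pos_kernel_scale[OF C(2), of "A * B\<^sup>2"]]]])
      (use A(1) in \<open>auto simp: algebra_simps\<close>)
  then show ?thesis
    using A(1) C(1) unfolding bounded_multiplier_def by (intro exI[of _ "A * B\<^sup>2 * C"]) auto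
qed

section \<open>Inclusions between M, H and the Hardy space\<close>

lemma H_subset_hardy: "f \<in> H \<Longrightarrow> f \<in> rkhs unit_disc szego"
  by (rule szego_dominates_K) (rule rkhs_mono)

lemma m_hardy_subset_H: "f \<in> rkhs unit_disc szego \<Longrightarrow> (\<lambda>z. m z * f z) \<in> H"
  by (rule K_dominates_m_szego) (rule rkhs_mult)

lemma M_subset_H: "\<phi> \<in> M \<Longrightarrow> \<phi> \<in> H"
proof -
  assume "\<phi> \<in> M"
  then have "(\<lambda>z. \<phi> z * cut (\<lambda>_. 1) z) \<in> H" and "\<And>z. z \<notin> unit_disc \<Longrightarrow> \<phi> z = 0"
    unfolding mult_alg_def using one_mem_H by (auto intro: multipliersD multipliers_outside)
  moreover from this(2) have "(\<lambda>z. \<phi> z * cut (\<lambda>_. 1) z) = \<phi>" by (auto simp: cut_def)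
  ultimately show ?thesis by simp
qed

lemma M_holomorphic: "\<phi> \<in> M \<Longrightarrow> \<phi> holomorphic_on unit_disc"
  by (intro rkhs_szego_holomorphic H_subset_hardy M_subset_H)

text \<open>In the coordinates \<open>g = (X + Y) / 2\<close> and \<open>(X - Y) / 2\<close> the kernel K has the same form,
  so that g is a contraction on H.\<close>

lemma bounded_multiplier_compose_g:
  assumes "\<psi> holomorphic_on unit_disc" "\<And>z. cmod z < 1 \<Longrightarrow> cmod (\<psi> z) \<le> B"
  shows "bounded_multiplier unit_disc K (\<lambda>z. \<psi> (g z))"
proof -
  \<comment> \<open>P is positive because \<psi> is a multiplier of the Hardy space, pulled back
    along g. Since K is the pulled back Szego kernel times 1 plus a congruence of K, the required
    kernel is P plus a congruence of P * K.\<close>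
  define P where "P = (\<lambda>z w. (complex_of_real (B\<^sup>2) - \<psi> (g z) * cnj (\<psi> (g w))) * szego (g z) (g w))"
  have P: "pos_kernel unit_disc P"
    unfolding P_def
    by (rule pos_kernel_pullback[OF pos_kernel_szego_contraction[OF assms]]) (auto simp: norm_g)
  define h where "h z = (X z - Y z) / 2" for z
  have "pos_kernel unit_disc (\<lambda>z w. (complex_of_real (B\<^sup>2) - \<psi> (g z) * cnj (\<psi> (g w))) * K z w)"
  proof (rule pos_kernel_cong[OF pos_kernel_add[OF P
        pos_kernel_congruence[OF pos_kernel_mult_K[OF P], of h]]])
    fix z w assume zw: "z \<in> unit_disc" "w \<in> unit_disc"
    have nz: "1 - g z * cnj (g w) \<noteq> 0"
      using one_minus_mult_cnj_nonzero[of "g z" "g w"] norm_g zw by (auto simp: less_imp_le)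
    have "g z * cnj (g w) + h z * cnj (h w) = (X z * cnj (X w) + Y z * cnj (Y w)) / 2"
      by (simp add: g_def h_def field_simps)
    then have "K z w = 1 + (g z * cnj (g w) + h z * cnj (h w)) * K z w"
      using K_expand[of z w] zw by (simp only: mem_unit_disc)
    then have "(1 - g z * cnj (g w)) * K z w = 1 + h z * cnj (h w) * K z w"
      by algebra
    then have "K z w = szego (g z) (g w) * (1 + h z * cnj (h w) * K z w)"
      using nz by (simp add: szego_def field_simps)
    then show "(complex_of_real (B\<^sup>2) - \<psi> (g z) * cnj (\<psi> (g w))) * K z w =
        P z w + h z * cnj (h w) * (P z w * K z w)"
      unfolding P_def by algebra
  qed
  then show ?thesis
    unfolding bounded_multiplier_def by (intro exI[of _ "B\<^sup>2"]) auto
qed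

text \<open>Division by z - a is possible in the Hardy space, and multiplication by m leads from
  there back to H.\<close>

lemma M_divide:
  assumes \<phi>: "\<phi> \<in> M" and a: "cmod a < 1"
  obtains p where "(\<lambda>z. m z * p z) \<in> M" "\<And>z. cmod z < 1 \<Longrightarrow> \<phi> z - \<phi> a = (z - a) * p z"
proof -
  define \<phi>0 where "\<phi>0 = (\<lambda>z. \<phi> z + (- \<phi> a) * cut (\<lambda>_. 1) z)"
  have \<phi>0: "\<phi>0 \<in> M"
    using \<phi> unfolding \<phi>0_def mult_alg_def
    by (intro multipliers_add multipliers_scale)
      (use multipliers_indicator[of unit_disc K] in \<open>auto simp: cut_def[abs_def]\<close>)
  have hol: "\<phi>0 holomorphic_on unit_disc" by (rule M_holomorphic[OF \<phi>0])
  have \<phi>0a: "\<phi>0 a = 0" using a by (simp add: \<phi>0_def)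
  define p where "p = cut (\<lambda>z. if z = a then deriv \<phi>0 a else \<phi>0 z / (z - a))"
  have p: "\<phi>0 z = (z - a) * p z" for z
    using \<phi>0a \<phi>0 by (auto simp: p_def cut_def mult_alg_def multipliers_outside)
  have hp: "p holomorphic_on unit_disc"
  proof -
    have "(\<lambda>z. if z = a then deriv \<phi>0 a else (\<phi>0 z - \<phi>0 a) / (z - a)) holomorphic_on unit_disc"
      by (rule pole_lemma_open[OF hol open_unit_disc])
    then show ?thesis
      by (rule holomorphic_transform) (simp add: p_def \<phi>0a)
  qed
  have "(\<lambda>z. m z * p z) \<in> M"
    unfolding mult_alg_def multipliers_def mem_Collect_eq
  proof (intro conjI allI impI ballI)
    fix f assume f: "f \<in> H"
    have "(\<lambda>z. (z - a) * (p z * f z)) \<in> rkhs unit_disc szego"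
      using H_subset_hardy[OF multipliersD[OF \<phi>0[unfolded mult_alg_def] f]] by (simp add: p mult.assoc)
    then have "(\<lambda>z. p z * f z) \<in> rkhs unit_disc szego"
    proof (rule rkhs_szego_divide[OF _ a])
      show "continuous_on unit_disc (\<lambda>z. p z * f z)"
        using rkhs_szego_holomorphic[OF H_subset_hardy[OF f]]
        by (intro holomorphic_on_imp_continuous_on holomorphic_intros hp)
    qed (simp add: p_def cut_def)
    from m_hardy_subset_H[OF this] show "(\<lambda>z. m z * p z * f z) \<in> H" by (simp add: mult.assoc)
  qed (simp add: p_def cut_def)
  moreover have "\<phi> z - \<phi> a = (z - a) * p z" if "cmod z < 1" for z
    using p[of z] that by (simp add: \<phi>0_def)
  ultimately show thesis by (rule that)
qed

end

section \<open>Characters and homomorphisms\<close>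

lemma holomorphic_into_disc_or_constant:
  assumes hol: "f holomorphic_on unit_disc" and le: "\<And>w. cmod w < 1 \<Longrightarrow> cmod (f w) \<le> 1"
  obtains "\<And>w. cmod w < 1 \<Longrightarrow> cmod (f w) < 1" | c where "\<And>w. cmod w < 1 \<Longrightarrow> f w = c"
proof (cases "\<exists>w. cmod w < 1 \<and> cmod (f w) = 1")
  case True
  then obtain w where w: "cmod w < 1" "cmod (f w) = 1" by blast
  have "f constant_on unit_disc"
    by (rule maximum_modulus_principle[OF hol open_unit_disc _ open_unit_disc order_refl, of w])
      (use w le in \<open>auto simp: unit_disc_eq\<close>)
  then show thesis using that(2) by (auto simp: constant_on_def)
next
  case False
  then show thesis using that(1) le by (metis order_le_less)
qed

lemma holomorphic_cball_bounded:
  fixes f :: "complex \<Rightarrow> complex"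
  assumes "f holomorphic_on cball 0 1"
  obtains B where "\<And>z. cmod z < 1 \<Longrightarrow> cmod (f z) \<le> B"
proof -
  have "compact (f ` cball 0 1)"
    by (intro compact_continuous_image holomorphic_on_imp_continuous_on assms) auto
  then obtain B where "\<forall>z\<in>cball 0 1. cmod (f z) \<le> B"
    by (auto simp: bounded_iff dest!: compact_imp_bounded)
  then show thesis by (intro that[of B]) auto
qed

context crossing_disc
begin

lemma M_cut: "bounded_multiplier unit_disc K \<phi> \<Longrightarrow> cut \<phi> \<in> M"
  unfolding mult_alg_def by (rule cut_multipliers)

lemma bounded_multiplier_g: "bounded_multiplier unit_disc K g"
  and bounded_multiplier_m: "bounded_multiplier unit_disc K m"
  and bounded_multiplier_m_id: "bounded_multiplier unit_disc K (\<lambda>z. m z * z)"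
  using bounded_multiplier_compose_g[of "\<lambda>z. z" 1] bounded_multiplier_m_mult[of "\<lambda>z. z" 1]
    bounded_multiplier_m_mult[of "\<lambda>z. 1" 1]
  by (simp_all add: less_imp_le)

section \<open>Behaviour of 1 - X, 1 - Y and 1 - g at the crossing\<close>

lemma one_minus_X_Y:
  assumes "cmod z \<le> 1"
  shows "1 - X z = (1 - \<rho>\<^sup>2) * (1 - z\<^sup>2) / (1 - \<rho> * z)\<^sup>2"
    and "1 - Y z = (1 - \<rho>\<^sup>2) * (1 - z\<^sup>2) / (1 + \<rho> * z)\<^sup>2"
proof -
  have nz: "1 - \<rho> * z \<noteq> 0" "1 + \<rho> * z \<noteq> 0" using denominator_nonzero assms by auto
  have quot: "1 - (u / v)\<^sup>2 = (v\<^sup>2 - u\<^sup>2) / v\<^sup>2" if "v \<noteq> 0" for u v :: complex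
    using that by (simp add: power_divide diff_divide_distrib)
  have "1 - X z = ((1 - \<rho> * z)\<^sup>2 - (z - \<rho>)\<^sup>2) / (1 - \<rho> * z)\<^sup>2"
    unfolding X_def x_def' by (rule quot[OF nz(1)])
  also have "(1 - \<rho> * z)\<^sup>2 - (z - \<rho>)\<^sup>2 = (1 - \<rho>\<^sup>2) * (1 - z\<^sup>2)" by algebra
  finally show "1 - X z = (1 - \<rho>\<^sup>2) * (1 - z\<^sup>2) / (1 - \<rho> * z)\<^sup>2" .
  have "1 - Y z = ((1 + \<rho> * z)\<^sup>2 - (z + \<rho>)\<^sup>2) / (1 + \<rho> * z)\<^sup>2"
    unfolding Y_def y_def' by (rule quot[OF nz(2)])
  also have "(1 + \<rho> * z)\<^sup>2 - (z + \<rho>)\<^sup>2 = (1 - \<rho>\<^sup>2) * (1 - z\<^sup>2)" by algebra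
  finally show "1 - Y z = (1 - \<rho>\<^sup>2) * (1 - z\<^sup>2) / (1 + \<rho> * z)\<^sup>2" .
qed

lemma one_minus_g:
  assumes "cmod z \<le> 1"
  shows "1 - g z = (1 - \<rho>\<^sup>2) * (1 - z\<^sup>2) * (1 + \<rho>\<^sup>2 * z\<^sup>2) / ((1 - \<rho> * z) * (1 + \<rho> * z))\<^sup>2"
proof -
  have nz: "1 - \<rho> * z \<noteq> 0" "1 + \<rho> * z \<noteq> 0" using denominator_nonzero assms by auto
  have sum: "A / a\<^sup>2 + A / b\<^sup>2 = A * (b\<^sup>2 + a\<^sup>2) / (a * b)\<^sup>2"
    if "a \<noteq> 0" "b \<noteq> 0" for A a b :: complex
    using that by (simp add: field_simps)
  have "1 - g z = ((1 - X z) + (1 - Y z)) / 2" by (simp add: g_def field_simps)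
  also have "\<dots> = (1 - \<rho>\<^sup>2) * (1 - z\<^sup>2) * ((1 + \<rho> * z)\<^sup>2 + (1 - \<rho> * z)\<^sup>2)
      / ((1 - \<rho> * z) * (1 + \<rho> * z))\<^sup>2 / 2"
    unfolding one_minus_X_Y[OF assms] by (simp only: sum[OF nz])
  also have "(1 + \<rho> * z)\<^sup>2 + (1 - \<rho> * z)\<^sup>2 = 2 * (1 + \<rho>\<^sup>2 * z\<^sup>2)" by algebra
  also have "A * (2 * B) / C / 2 = A * B / C" for A B C :: complex by simp
  finally show ?thesis .
qed

text \<open>The cofactor of m is bounded, so a character that annihilates m also annihilates 1 -
  g.\<close>

lemma one_minus_g_squared:
  assumes "cmod z \<le> 1"
  shows "(1 - g z) * (1 - g z) = m z * ((1 + \<rho>\<^sup>2 * z\<^sup>2) / ((1 - \<rho> * z) * (1 + \<rho> * z)))\<^sup>2"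
  unfolding m_def one_minus_X_Y[OF assms] one_minus_g[OF assms]
  by (simp add: power2_eq_square mult_ac)

lemma m_nonzero: "cmod z < 1 \<Longrightarrow> m z \<noteq> 0"
  unfolding m_def using norm_X[of z] norm_Y[of z] by auto

lemma g_one: "g 1 = 1"
  using one_minus_g[of 1] by simp

lemma M_separates:
  assumes "cmod a < 1" "cmod b < 1" "\<And>\<phi>. \<phi> \<in> M \<Longrightarrow> \<phi> a = \<phi> b"
  shows "a = b"
proof -
  have "m a = m b" "m a * a = m b * b"
    using assms(3)[OF M_cut[OF bounded_multiplier_m]] assms(3)[OF M_cut[OF bounded_multiplier_m_id]]
      assms(1,2) by simp_all
  then show ?thesis using m_nonzero[OF assms(1)] by simp
qed

text \<open>A unital algebra homomorphism from M to the complex numbers. The unit is the indicator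
  of the disc because members of M vanish off the disc.\<close>

definition character :: "((complex \<Rightarrow> complex) \<Rightarrow> complex) \<Rightarrow> bool" where
  "character \<xi> \<longleftrightarrow> (\<forall>a\<in>M. \<forall>b\<in>M. \<xi> (\<lambda>z. a z + b z) = \<xi> a + \<xi> b \<and> \<xi> (\<lambda>z. a z * b z) = \<xi> a * \<xi> b) \<and>
     (\<forall>a\<in>M. \<forall>c. \<xi> (\<lambda>z. c * a z) = c * \<xi> a) \<and> \<xi> (cut (\<lambda>_. 1)) = 1"

lemma
  assumes "character \<xi>"
  shows character_one: "\<xi> (cut (\<lambda>_. 1)) = 1"
    and character_mult: "a \<in> M \<Longrightarrow> b \<in> M \<Longrightarrow> \<xi> (\<lambda>z. a z * b z) = \<xi> a * \<xi> b"
    and character_minus_const: "a \<in> M \<Longrightarrow> \<xi> (\<lambda>z. a z - c * cut (\<lambda>_. 1) z) = \<xi> a - c"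
    and character_diff_scale: "a \<in> M \<Longrightarrow> b \<in> M \<Longrightarrow> \<xi> (\<lambda>z. a z - c * b z) = \<xi> a - c * \<xi> b"
proof -
  show 1: "\<xi> (cut (\<lambda>_. 1)) = 1" and "a \<in> M \<Longrightarrow> b \<in> M \<Longrightarrow> \<xi> (\<lambda>z. a z * b z) = \<xi> a * \<xi> b"
    using assms by (auto simp: character_def)
  show 2: "\<xi> (\<lambda>z. a z - c * b z) = \<xi> a - c * \<xi> b" if "a \<in> M" "b \<in> M" for a b
  proof -
    have cb: "(\<lambda>z. - c * b z) \<in> M" using that(2) unfolding mult_alg_def by (rule multipliers_scale)
    have "\<xi> (\<lambda>z. a z + - c * b z) = \<xi> a + \<xi> (\<lambda>z. - c * b z)"
      by (rule conjunct1[OF assms[unfolded character_def, THEN conjunct1, rule_format, OF that(1) cb]])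
    also have "\<xi> (\<lambda>z. - c * b z) = - c * \<xi> b"
      by (rule assms[unfolded character_def, THEN conjunct2, THEN conjunct1, rule_format, OF that(2)])
    finally show ?thesis by simp
  qed
  show "a \<in> M \<Longrightarrow> \<xi> (\<lambda>z. a z - c * cut (\<lambda>_. 1) z) = \<xi> a - c"
    using 2[of a "cut (\<lambda>_. 1)"] M_cut[OF bounded_multiplier_const[OF pos_kernel_K]] 1 by simp
qed

lemma M_minus_scale: "a \<in> M \<Longrightarrow> b \<in> M \<Longrightarrow> (\<lambda>z. a z - c * b z) \<in> M"
  unfolding mult_alg_def
  using multipliers_add[of a unit_disc K "\<lambda>z. - c * b z"] multipliers_scale[of b unit_disc K "- c"] by simp

lemma M_one: "cut (\<lambda>_. 1) \<in> M"
  by (rule M_cut[OF bounded_multiplier_const[OF pos_kernel_K]])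

lemma inverse_shift_bounded:
  assumes "cmod c > 1"
  shows "(\<lambda>u. 1 / (u - c)) holomorphic_on unit_disc"
    and "cmod u < 1 \<Longrightarrow> cmod (1 / (u - c)) \<le> 1 / (cmod c - 1)"
proof -
  show "(\<lambda>u. 1 / (u - c)) holomorphic_on unit_disc"
    using assms by (auto intro!: holomorphic_intros)
  assume "cmod u < 1"
  then have "cmod c - 1 \<le> cmod (u - c)"
    using norm_triangle_ineq2[of c u] by (simp add: norm_minus_commute)
  then show "cmod (1 / (u - c)) \<le> 1 / (cmod c - 1)"
    using assms by (simp add: norm_divide frac_le)
qed

text \<open>For c outside the closed disc, 1 / (u - c) is bounded on the disc, so g - c has an
  inverse in M; a character cannot annihilate an invertible element.\<close>

lemma character_g:
  assumes \<xi>: "character \<xi>"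
  shows "cmod (\<xi> (cut g)) \<le> 1"
proof (rule ccontr)
  define c where "c = \<xi> (cut g)"
  assume "\<not> cmod (\<xi> (cut g)) \<le> 1"
  then have c: "cmod c > 1" by (simp add: c_def)
  have gM: "cut g \<in> M" by (rule M_cut[OF bounded_multiplier_g])
  have iM: "cut (\<lambda>z. 1 / (g z - c)) \<in> M"
    by (rule M_cut[OF bounded_multiplier_compose_g[OF inverse_shift_bounded[OF c]]])
  have "(\<lambda>z. (cut g z - c * cut (\<lambda>_. 1) z) * cut (\<lambda>z. 1 / (g z - c)) z) = cut (\<lambda>_. 1)"
    using norm_g c by (force simp: cut_def)
  then have "(\<xi> (cut g) - c) * \<xi> (cut (\<lambda>z. 1 / (g z - c))) = 1"
    using character_mult[OF \<xi> M_minus_scale[OF gM M_one, of c] iM]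
      character_minus_const[OF \<xi> gM, of c] character_one[OF \<xi>] by simp
  then show False by (simp add: c_def)
qed

text \<open>m times a bounded function lies in the kernel of a character together with m,
  because \<open>(m * \<psi>)\<^sup>2 = m * (m * \<psi>\<^sup>2)\<close>.\<close>

lemma character_m_zero:
  assumes \<xi>: "character \<xi>" and 0: "\<xi> (cut m) = 0"
  shows "\<xi> (cut g) = 1"
proof -
  define u where "u z = ((1 + \<rho>\<^sup>2 * z\<^sup>2) / ((1 - \<rho> * z) * (1 + \<rho> * z)))\<^sup>2" for z
  have hu: "u holomorphic_on cball 0 1"
    unfolding u_def by (intro holomorphic_intros) (use denominator_nonzero in force)
  have M1: "cut (\<lambda>z. m z * \<psi> z) \<in> M" if h: "\<psi> holomorphic_on cball 0 1" for \<psi>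
  proof -
    obtain B where "\<And>z. cmod z < 1 \<Longrightarrow> cmod (\<psi> z) \<le> B"
      using holomorphic_cball_bounded[OF h] by blast
    then show ?thesis
      using h by (intro M_cut bounded_multiplier_m_mult)
        (auto simp: unit_disc_eq elim: holomorphic_on_subset)
  qed
  have mM: "cut m \<in> M" by (rule M_cut[OF bounded_multiplier_m])
  have uM: "cut (\<lambda>z. m z * u z) \<in> M" and uuM: "cut (\<lambda>z. m z * (u z * u z)) \<in> M"
    by (auto intro!: M1 hu holomorphic_intros)
  have "(\<lambda>z. cut (\<lambda>z. m z * u z) z * cut (\<lambda>z. m z * u z) z) = (\<lambda>z. cut m z * cut (\<lambda>z. m z * (u z * u z)) z)"
    by (auto simp: cut_def)
  then have "\<xi> (cut (\<lambda>z. m z * u z)) * \<xi> (cut (\<lambda>z. m z * u z)) = 0"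
    using character_mult[OF \<xi> uM uM] character_mult[OF \<xi> mM uuM] 0 by simp
  then have mu: "\<xi> (cut (\<lambda>z. m z * u z)) = 0" by simp
  have gM: "cut g \<in> M" by (rule M_cut[OF bounded_multiplier_g])
  have dM: "(\<lambda>z. cut g z - 1 * cut (\<lambda>_. 1) z) \<in> M" by (rule M_minus_scale[OF gM M_one])
  have "(\<lambda>z. (cut g z - 1 * cut (\<lambda>_. 1) z) * (cut g z - 1 * cut (\<lambda>_. 1) z)) = cut (\<lambda>z. m z * u z)"
    using one_minus_g_squared by (auto simp: cut_def u_def algebra_simps)
  then have "(\<xi> (cut g) - 1) * (\<xi> (cut g) - 1) = 0"
    using character_mult[OF \<xi> dM dM] mu unfolding character_minus_const[OF \<xi> gM] by simp
  then show ?thesis by simp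
qed

lemma character_evaluation:
  assumes \<xi>: "character \<xi>" and nz: "\<xi> (cut m) \<noteq> 0"
  defines "\<mu> \<equiv> \<xi> (cut (\<lambda>z. m z * z)) / \<xi> (cut m)"
  shows "cmod \<mu> \<le> 1" and "cmod \<mu> < 1 \<Longrightarrow> \<phi> \<in> M \<Longrightarrow> \<xi> \<phi> = \<phi> \<mu>"
proof -
  have mM: "cut m \<in> M" and zM: "cut (\<lambda>z. m z * z) \<in> M"
    by (auto intro!: M_cut bounded_multiplier_m bounded_multiplier_m_id)
  have dM: "(\<lambda>z. cut (\<lambda>z. m z * z) z - \<mu> * cut m z) \<in> M" by (rule M_minus_scale[OF zM mM])
  have d0: "\<xi> (\<lambda>z. cut (\<lambda>z. m z * z) z - \<mu> * cut m z) = 0"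
    unfolding character_diff_scale[OF \<xi> zM mM] using nz by (simp add: \<mu>_def)
  show "cmod \<mu> \<le> 1"
  proof (rule ccontr)
    assume "\<not> cmod \<mu> \<le> 1"
    then have c: "cmod \<mu> > 1" by simp
    have iM: "cut (\<lambda>z. m z * (1 / (z - \<mu>))) \<in> M"
      by (rule M_cut[OF bounded_multiplier_m_mult[OF inverse_shift_bounded[OF c]]])
    have "(\<lambda>z. (cut (\<lambda>z. m z * z) z - \<mu> * cut m z) * cut (\<lambda>z. m z * (1 / (z - \<mu>))) z)
        = (\<lambda>z. cut m z * cut m z)"
    proof
      fix z
      show "(cut (\<lambda>z. m z * z) z - \<mu> * cut m z) * cut (\<lambda>z. m z * (1 / (z - \<mu>))) z = cut m z * cut m z"
      proof (cases "cmod z < 1")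
        case True
        then have "z - \<mu> \<noteq> 0" using c by auto
        moreover have "(m z * z - \<mu> * m z) * (m z * (1 / (z - \<mu>))) = (z - \<mu>) * (1 / (z - \<mu>)) * (m z * m z)"
          by algebra
        ultimately show ?thesis using True by simp
      qed (simp add: cut_def)
    qed
    then have "\<xi> (cut m) * \<xi> (cut m) = 0"
      using character_mult[OF \<xi> dM iM] character_mult[OF \<xi> mM mM] d0 by simp
    then show False using nz by simp
  qed
  assume \<mu>: "cmod \<mu> < 1" and \<phi>: "\<phi> \<in> M"
  obtain p where pM: "(\<lambda>z. m z * p z) \<in> M" and p: "\<And>z. cmod z < 1 \<Longrightarrow> \<phi> z - \<phi> \<mu> = (z - \<mu>) * p z"
    using M_divide[OF \<phi> \<mu>] by blast
  have mmM: "(\<lambda>z. cut m z * cut m z) \<in> M"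
    using mM unfolding mult_alg_def by (intro multipliers_mult)
  have \<phi>M: "(\<lambda>z. \<phi> z - \<phi> \<mu> * cut (\<lambda>_. 1) z) \<in> M" by (rule M_minus_scale[OF \<phi> M_one])
  have "(\<lambda>z. (cut m z * cut m z) * (\<phi> z - \<phi> \<mu> * cut (\<lambda>_. 1) z)) =
      (\<lambda>z. (cut (\<lambda>z. m z * z) z - \<mu> * cut m z) * (m z * p z))"
  proof
    fix z
    show "(cut m z * cut m z) * (\<phi> z - \<phi> \<mu> * cut (\<lambda>_. 1) z) =
      (cut (\<lambda>z. m z * z) z - \<mu> * cut m z) * (m z * p z)"
    proof (cases "cmod z < 1")
      case True
      have "(m z * m z) * (\<phi> z - \<phi> \<mu>) = (m z * z - \<mu> * m z) * (m z * p z)"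
        using p[OF True] by algebra
      then show ?thesis using True by simp
    qed (simp add: cut_def)
  qed
  then have "\<xi> (cut m) * \<xi> (cut m) * (\<xi> \<phi> - \<phi> \<mu>) = 0"
    using character_mult[OF \<xi> mmM \<phi>M] character_mult[OF \<xi> mM mM] character_mult[OF \<xi> dM pM] d0
    unfolding character_minus_const[OF \<xi> \<phi>] by simp
  then show "\<xi> \<phi> = \<phi> \<mu>" using nz by simp
qed

text \<open>Each w gives a character, which should be evaluation at F w. The two degenerate cases, m
  annihilated or F w on the circle, would make a holomorphic function constant in w; injectivity
  carries the constancy back to M, where it is false.\<close>

lemma homomorphism_is_composition:
  assumes hol: "\<And>a. a \<in> M \<Longrightarrow> \<Phi> a holomorphic_on unit_disc"
    and char: "\<And>w. cmod w < 1 \<Longrightarrow> character (\<lambda>a. \<Phi> a w)"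
    and inj: "\<And>a b. a \<in> M \<Longrightarrow> b \<in> M \<Longrightarrow> (\<And>w. cmod w < 1 \<Longrightarrow> \<Phi> a w = \<Phi> b w) \<Longrightarrow> a = b"
  obtains F where "F holomorphic_on unit_disc" "\<And>w. cmod w < 1 \<Longrightarrow> cmod (F w) < 1"
    "\<And>\<phi> w. \<phi> \<in> M \<Longrightarrow> cmod w < 1 \<Longrightarrow> \<Phi> \<phi> w = \<phi> (F w)"
proof -
  have mM: "cut m \<in> M" and zM: "cut (\<lambda>z. m z * z) \<in> M" and gM: "cut g \<in> M"
    by (auto intro!: M_cut bounded_multiplier_m bounded_multiplier_m_id bounded_multiplier_g)
  have scaleM: "a \<in> M \<Longrightarrow> (\<lambda>z. c * a z) \<in> M" for a c
    unfolding mult_alg_def by (rule multipliers_scale)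
  have scale: "\<Phi> (\<lambda>z. c * a z) w = c * \<Phi> a w" if "cmod w < 1" "a \<in> M" for a c w
    using char[OF that(1)] that(2) by (auto simp: character_def)
  have one: "\<Phi> (cut (\<lambda>_. 1)) w = 1" if "cmod w < 1" for w
    using char[OF that] by (auto simp: character_def)
  \<comment> \<open>If modulus 1 were attained, the image of g and hence g itself would be constant,
    but g 1 = 1 while g 0 is inside the disc.\<close>
  have g_lt: "cmod (\<Phi> (cut g) w) < 1" if w: "cmod w < 1" for w
  proof (rule holomorphic_into_disc_or_constant[OF hol[OF gM]])
    show "cmod (\<Phi> (cut g) w) \<le> 1" if "cmod w < 1" for w by (rule character_g[OF char[OF that]])
    fix c assume c: "\<And>w. cmod w < 1 \<Longrightarrow> \<Phi> (cut g) w = c"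
    have "cut g = (\<lambda>z. c * cut (\<lambda>_. 1) z)"
      by (rule inj[OF gM scaleM[OF M_one]]) (simp add: scale M_one one c)
    then have gc: "g z = c" if "cmod z < 1" for z using that by (metis cut_in mult.right_neutral)
    have "g 1 = c"
      by (rule continuous_constant_on_closure[of "ball 0 1" g c 1])
        (auto simp: gc intro: holomorphic_on_imp_continuous_on holomorphic_g)
    then show ?thesis using gc[of 0] norm_g[of 0] g_one by simp
  qed (use w in auto)
  define F where "F w = \<Phi> (cut (\<lambda>z. m z * z)) w / \<Phi> (cut m) w" for w
  have nz: "\<Phi> (cut m) w \<noteq> 0" if "cmod w < 1" for w
    using character_m_zero[OF char[OF that]] g_lt[OF that] by auto
  have hF: "F holomorphic_on unit_disc"
    unfolding F_def by (intro holomorphic_intros hol mM zM) (simp add: nz)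
  \<comment> \<open>A constant F would make m * z a constant multiple of m, although m has no zero
    in the disc.\<close>
  have F1: "cmod (F w) < 1" if w: "cmod w < 1" for w
  proof (rule holomorphic_into_disc_or_constant[OF hF])
    show "cmod (F w) \<le> 1" if "cmod w < 1" for w
      using character_evaluation(1)[OF char[OF that] nz[OF that]] by (simp add: F_def)
    fix c assume c: "\<And>w. cmod w < 1 \<Longrightarrow> F w = c"
    have "cut (\<lambda>z. m z * z) = (\<lambda>z. c * cut m z)"
      by (rule inj[OF zM scaleM[OF mM]]) (simp add: scale mM c[symmetric], simp add: F_def nz)
    then have "m z * z = c * m z" if "cmod z < 1" for z using that by (metis cut_in)
    then have "z = c" if "cmod z < 1" for z
      using that m_nonzero[OF that] by (metis mult.commute mult_cancel_left)
    from this[of 0] this[of "1/2"] show ?thesis by (simp add: norm_divide)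
  qed (use w in auto)
  show thesis
  proof (rule that[OF hF F1])
    fix \<phi> w assume \<phi>: "\<phi> \<in> M" and w: "cmod w < 1"
    show "\<Phi> \<phi> w = \<phi> (F w)"
      using character_evaluation(2)[OF char[OF w] nz[OF w] _ \<phi>] F1[OF w] by (simp add: F_def)
  qed
qed

end

text \<open>Moving the zero a of F to the origin gives a map T fixing 0 whose inverse U also fixes
  0. The Schwarz lemma for both forces T to be a rotation.\<close>

lemma disc_automorphism:
  assumes F: "F holomorphic_on unit_disc" "\<And>w. cmod w < 1 \<Longrightarrow> cmod (F w) < 1"
    and G: "G holomorphic_on unit_disc" "\<And>w. cmod w < 1 \<Longrightarrow> cmod (G w) < 1"
    and FG: "\<And>w. cmod w < 1 \<Longrightarrow> F (G w) = w" and GF: "\<And>w. cmod w < 1 \<Longrightarrow> G (F w) = w"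
  obtains c a where "cmod c = 1" "cmod a < 1"
    "\<And>z. cmod z < 1 \<Longrightarrow> F z = c * (z - a) / (1 - cnj a * z)"
proof -
  define a where "a = G 0"
  have a: "cmod a < 1" using G(2)[of 0] by (simp add: a_def)
  have Fa: "F a = 0" using FG[of 0] by (simp add: a_def)
  define P where "P = Moebius_function 0 a"
  define N where "N = Moebius_function 0 (- a)"
  have PN: "cmod (P z) < 1" "cmod (N z) < 1" "P (N z) = z" "N (P z) = z" if "cmod z < 1" for z
    using that a by (auto simp: P_def N_def intro!: Moebius_function_norm_lt_1 Moebius_function_compose)
  have N0: "N 0 = a" "P a = 0" by (simp_all add: N_def P_def Moebius_function_simple)
  have hol: "P holomorphic_on ball 0 1" "N holomorphic_on ball 0 1"
    using a by (auto simp: P_def N_def intro!: Moebius_function_holomorphic)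
  define T where "T z = F (N z)" for z
  define U where "U z = P (G z)" for z
  have hT: "T holomorphic_on ball 0 1"
    unfolding T_def using holomorphic_on_compose_gen[OF hol(2) F(1)] PN
    by (simp add: o_def image_subset_iff)
  have hU: "U holomorphic_on ball 0 1"
    unfolding U_def using holomorphic_on_compose_gen[OF G(1) hol(1)] G(2)
    by (simp add: o_def image_subset_iff flip: unit_disc_eq)
  have T1: "cmod (T z) < 1" and U1: "cmod (U z) < 1" if "cmod z < 1" for z
    using that PN F G by (auto simp: T_def U_def)
  have T0: "T 0 = 0" "U 0 = 0" by (simp_all add: T_def U_def N0 Fa a_def[symmetric])
  have UT: "U (T z) = z" if "cmod z < 1" for z
    using that PN GF by (simp add: U_def T_def)
  \<comment> \<open>Equality in the Schwarz lemma at one nonzero point suffices; 1/2 is an arbitrary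
    choice.\<close>
  have "cmod (T (1/2)) = cmod (1/2)"
    using Schwarz_Lemma(1)[OF hT T0(1) T1, of "1/2"] Schwarz_Lemma(1)[OF hU T0(2) U1, of "T (1/2)"]
      UT[of "1/2"] T1[of "1/2"] by (simp add: norm_divide)
  then have "\<exists>\<alpha>. (\<forall>z. cmod z < 1 \<longrightarrow> T z = \<alpha> * z) \<and> cmod \<alpha> = 1"
    by (intro Schwarz_Lemma(3)[OF hT T0(1) T1, of 0] disjI1 exI[of _ "1/2"]) (auto simp: norm_divide)
  then obtain c where c: "\<And>z. cmod z < 1 \<Longrightarrow> T z = c * z" "cmod c = 1"
    by blast
  have "F z = c * (z - a) / (1 - cnj a * z)" if "cmod z < 1" for z
    using c(1)[OF PN(1)[OF that]] PN(4)[OF that] by (simp add: T_def P_def Moebius_function_simple)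
  then show thesis using that c(2) a by blast
qed

section \<open>Multipliers at the self-crossing\<close>

context crossing_disc
begin

definition "Xr t = ((t - r) / (1 - r * t))\<^sup>2"
definition "Yr t = ((t + r) / (1 + r * t))\<^sup>2"
definition "kr t = 1 / (1 - ((Xr t)\<^sup>2 + (Yr t)\<^sup>2) / 2)"

section \<open>Reflection symmetry and the kernel on the real diameter\<close>

lemma X_minus: "X (- z) = Y z" and Y_minus: "Y (- z) = X z"
proof -
  have "x (- z) = - y z"
    unfolding blaschke_def minus_divide_left by simp
  moreover have "y (- z) = - x z"
    unfolding blaschke_def minus_divide_left by simp
  ultimately show "X (- z) = Y z" "Y (- z) = X z" by (simp_all add: X_def Y_def)
qed

lemma X_of_real: "X (of_real t) = of_real (Xr t)" and Y_of_real: "Y (of_real t) = of_real (Yr t)"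
  by (simp_all add: X_def Y_def x_def' y_def' Xr_def Yr_def)

lemma Xr_nonneg: "0 \<le> Xr t" and Yr_nonneg: "0 \<le> Yr t"
  by (simp_all add: Xr_def Yr_def)

lemma Xr_less: "\<bar>t\<bar> < 1 \<Longrightarrow> Xr t < 1" and Yr_less: "\<bar>t\<bar> < 1 \<Longrightarrow> Yr t < 1"
  using norm_X[of "of_real t"] norm_Y[of "of_real t"] Xr_nonneg[of t] Yr_nonneg[of t]
  by (simp_all add: X_of_real Y_of_real)

lemma K_of_real: "K (of_real s) (of_real t) = of_real (1 / (1 - (Xr s * Xr t + Yr s * Yr t) / 2))"
  by (simp add: K_eq X_of_real Y_of_real)

lemma K_of_real_nonneg:
  assumes "\<bar>s\<bar> < 1" "\<bar>t\<bar> < 1"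
  shows "0 \<le> Re (K (of_real s) (of_real t))"
proof -
  have "Xr s * Xr t \<le> 1 * 1" "Yr s * Yr t \<le> 1 * 1"
    using assms Xr_less Yr_less Xr_nonneg Yr_nonneg by (intro mult_mono; simp add: less_imp_le)+
  then show ?thesis unfolding K_of_real by simp
qed

lemma K_diag: "K (of_real t) (of_real t) = of_real (kr t)"
  by (simp add: K_of_real kr_def power2_eq_square)

lemma K_minus_minus: "K (- z) (- w) = K z w"
  by (simp add: K_eq X_minus Y_minus add.commute)

lemma K_cnj: "cnj (K z w) = K w z"
  by (simp add: K_eq mult.commute)

lemma kr_ge_one: "\<bar>t\<bar> < 1 \<Longrightarrow> kr t \<ge> 1"
proof -
  assume t: "\<bar>t\<bar> < 1"
  have "(Xr t)\<^sup>2 < 1" "(Yr t)\<^sup>2 < 1"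
    using Xr_less[OF t] Yr_less[OF t] Xr_nonneg[of t] Yr_nonneg[of t]
    by (simp_all add: power_less_one_iff)
  then show ?thesis by (simp add: kr_def divide_simps)
qed

text \<open>The two sheets are tangent at the crossing to such an order that the distance between the
  kernel functions at t and -t stays bounded although their norms tend to infinity.\<close>

lemma K_sheets_close:
  assumes t: "\<bar>t\<bar> < 1"
  shows "Re (K (of_real t) (of_real t)) - Re (K (of_real t) (- of_real t)) \<le> 1"
proof -
  define a b where "a = Xr t" and "b = Yr t"
  have ab: "0 \<le> a" "a < 1" "0 \<le> b" "b < 1"
    using Xr_less[OF t] Yr_less[OF t] Xr_nonneg[of t] Yr_nonneg[of t] by (simp_all add: a_def b_def)
  \<comment> \<open>d and e are the reciprocals of K at (t, -t) and at (t, t).\<close>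
  define d e where "d = 1 - a * b" and "e = 1 - (a\<^sup>2 + b\<^sup>2) / 2"
  have "a * b \<le> a" "a * b \<le> b" "a\<^sup>2 \<le> a" "b\<^sup>2 \<le> b"
    using ab by (auto simp: power2_eq_square intro: mult_left_le mult_left_le_one_le)
  moreover have "2 * e = 2 - a\<^sup>2 - b\<^sup>2" "d = 1 - a * b" by (simp_all add: d_def e_def add_divide_distrib)
  ultimately have de: "\<bar>a - b\<bar> \<le> d" "\<bar>a - b\<bar> \<le> 2 * e" "d > 0" "e > 0"
    using ab unfolding abs_le_iff by linarith+
  from de have "\<bar>a - b\<bar> * \<bar>a - b\<bar> \<le> d * (2 * e)" by (intro mult_mono) auto
  then have "(a - b)\<^sup>2 / 2 \<le> d * e" by (simp add: power2_eq_square)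
  moreover have "1 / e - 1 / d = ((a - b)\<^sup>2 / 2) / (d * e)"
  proof -
    have "1 / e - 1 / d = (d - e) / (d * e)" using \<open>d > 0\<close> \<open>e > 0\<close> by (simp add: field_simps)
    also have "d - e = (a - b)\<^sup>2 / 2" by (simp add: d_def e_def power2_eq_square add_divide_distrib diff_divide_distrib algebra_simps)
    finally show ?thesis .
  qed
  ultimately have "1 / e - 1 / d \<le> 1"
    using mult_pos_pos[OF de(3,4)] by (simp only: divide_le_eq_1_pos)
  moreover have "K (of_real t) (- of_real t) = of_real (1 / d)"
    by (simp add: K_eq X_minus Y_minus X_of_real Y_of_real d_def a_def b_def mult.commute)
  ultimately show ?thesis by (simp add: K_diag kr_def e_def a_def b_def)
qed

text \<open>The difference of the evaluations at t and -t is a functional of squared norm at most 2,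
  by \<open>K_sheets_close\<close>; a single evaluation has squared norm
  \<open>kr t\<close>.\<close>

lemma H_pointwise_bounds:
  assumes f: "f \<in> H"
  obtains C where "C > 0" "\<And>t. \<bar>t\<bar> < 1 \<Longrightarrow> (cmod (f (of_real t) - f (- of_real t)))\<^sup>2 \<le> C"
    "\<And>t. \<bar>t\<bar> < 1 \<Longrightarrow> (cmod (f (- of_real t)))\<^sup>2 \<le> C * kr t"
proof -
  obtain C where C: "C > 0"
    and pos: "pos_kernel unit_disc (\<lambda>z w. complex_of_real C * K z w - f z * cnj (f w))"
    using rkhsE[OF f pos_kernel_K] by blast
  show thesis
  proof (rule that[of "2 * C"])
    fix t :: real assume t: "\<bar>t\<bar> < 1"
    define p where "p i = (if i = 0 then complex_of_real t else - of_real t)" for i :: nat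
    define c where "c i = (if i = 0 then 1 else - 1 :: complex)" for i :: nat
    have "(cmod (\<Sum>i<2. c i * f (p i)))\<^sup>2 \<le> C * Re (quad K 2 p c)"
      by (rule rkhs_functional_bound[OF pos]) (use t in \<open>auto simp: p_def\<close>)
    also have "(\<Sum>i<2. c i * f (p i)) = f (of_real t) - f (- of_real t)"
      by (simp add: c_def p_def eval_nat_numeral)
    also have "Re (quad K 2 p c) = 2 * (Re (K (of_real t) (of_real t)) - Re (K (of_real t) (- of_real t)))"
      using K_minus_minus[of "of_real t" "of_real t"] K_minus_minus[of "of_real t" "- of_real t"]
      by (simp add: quad_def c_def p_def eval_nat_numeral)
    also have "C * \<dots> \<le> C * (2 * 1)"
      using K_sheets_close[OF t] C by (intro mult_left_mono) auto
    finally show "(cmod (f (of_real t) - f (- of_real t)))\<^sup>2 \<le> 2 * C" by simp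
    have "(cmod (f (- of_real t)))\<^sup>2 \<le> C * kr t"
      using rkhs_functional_bound[OF pos, of 1 "\<lambda>_. - of_real t" "\<lambda>_. 1"] t
        K_minus_minus[of "of_real t" "of_real t"]
      by (simp add: quad_def K_diag)
    also have "\<dots> \<le> 2 * C * kr t" using C kr_ge_one[OF t] by simp
    finally show "(cmod (f (- of_real t)))\<^sup>2 \<le> 2 * C * kr t" .
  qed (use C in auto)
qed

text \<open>The Cauchy-Schwarz inequality for the kernel function at t, whose norm is
  \<open>sqrt (kr t)\<close>; it is read off from the Schur complement at t.\<close>

lemma kernel_function_bound:
  assumes p: "\<And>i. i < n \<Longrightarrow> p i \<in> unit_disc" and t: "\<bar>t\<bar> < 1"
  shows "cmod (\<Sum>i<n. c i * K (p i) (of_real t)) \<le> sqrt (kr t) * sqrt (Re (quad K n p c))"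
proof -
  have nz: "K (of_real t) (of_real t) \<noteq> 0" using kr_ge_one[OF t] by (simp add: K_diag)
  have "pos_kernel unit_disc (\<lambda>z w. complex_of_real (kr t) * K z w - K z (of_real t) * cnj (K w (of_real t)))"
    by (rule pos_kernel_cong[OF pos_kernel_scale[OF pos_kernel_schur_complement[OF pos_kernel_K _ nz],
        of "kr t"]])
      (use kr_ge_one[OF t] t in \<open>auto simp: K_diag K_cnj right_diff_distrib\<close>)
  from rkhs_functional_bound[OF this p, where c = c]
  have "sqrt ((cmod (\<Sum>i<n. c i * K (p i) (of_real t)))\<^sup>2) \<le> sqrt (kr t * Re (quad K n p c))"
    by (intro real_sqrt_le_mono)
  then show ?thesis by (simp add: real_sqrt_mult)
qed

text \<open>Comparing \<open>\<phi>\<close> with \<open>\<phi> * f\<close> for such an f, and bounding \<open>\<phi>\<close> through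
  \<open>\<phi>\<^sup>2 \<in> H\<close>, replaces the closed graph theorem: the multipliers are not known to be bounded.\<close>

lemma H_large_function:
  assumes v: "\<And>k. \<bar>v k\<bar> < 1"
  obtains f where "f \<in> H" "\<And>k::nat. cmod (f (of_real (v k))) \<ge> sqrt (kr (v k)) / 2 ^ k"
proof -
  \<comment> \<open>a k scales the kernel function at v k to norm (1/2)^k, so that the sum f of the
    scaled functions has norm at most 2; this is the source of the constant 4.\<close>
  define a where "a k = (1 / 2) ^ k / sqrt (kr (v k))" for k
  have kp: "kr (v k) > 0" for k using kr_ge_one[OF v, of k] by simp
  have a: "a k > 0" "a k * sqrt (kr (v k)) = (1 / 2) ^ k" for k
    using kp[of k] by (auto simp: a_def)
  have geo: "summable (\<lambda>k. (1 / 2 :: real) ^ k)" "(\<Sum>k. (1 / 2 :: real) ^ k) = 2"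
    using summable_geometric[of "1/2::real"] suminf_geometric[of "1/2::real"] by simp_all
  define T where "T k z = complex_of_real (a k) * K z (of_real (v k))" for k z
  have T_le: "cmod (\<Sum>i<n. c i * T k (p i)) \<le> (1 / 2) ^ k * sqrt (Re (quad K n p c))"
    if p: "\<And>i. i < n \<Longrightarrow> p i \<in> unit_disc" for n p c k
  proof -
    have "(\<Sum>i<n. c i * T k (p i)) = of_real (a k) * (\<Sum>i<n. c i * K (p i) (of_real (v k)))"
      by (simp add: T_def sum_distrib_left mult_ac)
    then have "cmod (\<Sum>i<n. c i * T k (p i)) = a k * cmod (\<Sum>i<n. c i * K (p i) (of_real (v k)))"
      using a(1)[of k] by (simp add: norm_mult)
    also have "\<dots> \<le> a k * (sqrt (kr (v k)) * sqrt (Re (quad K n p c)))"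
      using a(1)[of k] by (intro mult_left_mono kernel_function_bound p v) auto
    finally show ?thesis by (simp only: mult.assoc[symmetric] a(2))
  qed
  have sT: "summable (\<lambda>k. T k z)" if z: "cmod z < 1" for z
  proof (rule summable_comparison_test)
    show "\<exists>N. \<forall>k\<ge>N. norm (T k z) \<le> (1 / 2) ^ k * sqrt (Re (quad K 1 (\<lambda>_. z) (\<lambda>_. 1)))"
      using T_le[of 1 "\<lambda>_. z" "\<lambda>_. 1"] z by auto
    show "summable (\<lambda>k. (1 / 2) ^ k * sqrt (Re (quad K 1 (\<lambda>_. z) (\<lambda>_. 1))))"
      by (intro summable_mult2 geo)
  qed
  define f where "f = cut (\<lambda>z. \<Sum>k. T k z)"
  have "f \<in> H"
  proof (rule rkhsI_functional_bound[OF pos_kernel_K, where C = 4])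
    fix n and p :: "nat \<Rightarrow> complex" and c assume p: "\<And>i. i < n \<Longrightarrow> p i \<in> unit_disc"
    have "(\<lambda>k. \<Sum>i<n. c i * T k (p i)) sums (\<Sum>i<n. c i * f (p i))"
      using p sT by (intro sums_sum sums_mult) (auto simp: f_def intro: summable_sums)
    then have s: "summable (\<lambda>k. \<Sum>i<n. c i * T k (p i))"
      "(\<Sum>k. \<Sum>i<n. c i * T k (p i)) = (\<Sum>i<n. c i * f (p i))" by (auto simp: sums_iff)
    have sg: "summable (\<lambda>k. (1 / 2) ^ k * sqrt (Re (quad K n p c)))"
      by (intro summable_mult2 geo)
    have "cmod (\<Sum>i<n. c i * f (p i)) \<le> (\<Sum>k. (1 / 2) ^ k * sqrt (Re (quad K n p c)))"
      unfolding s(2)[symmetric] by (rule norm_suminf_le[OF T_le[OF p] sg])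
    also have "\<dots> = 2 * sqrt (Re (quad K n p c))"
      using suminf_mult2[OF geo(1), symmetric] geo(2) by simp
    finally have "(cmod (\<Sum>i<n. c i * f (p i)))\<^sup>2 \<le> (2 * sqrt (Re (quad K n p c)))\<^sup>2"
      by (rule power_mono) simp
    also have "\<dots> = 4 * Re (quad K n p c)"
      using pos_kernelD[OF pos_kernel_K p, where c = c]
      by (simp add: power_mult_distrib complex_nonneg_Reals_iff)
    finally show "(cmod (\<Sum>i<n. c i * f (p i)))\<^sup>2 \<le> 4 * Re (quad K n p c)" .
  qed (auto simp: f_def cut_def)
  moreover have "cmod (f (of_real (v j))) \<ge> sqrt (kr (v j)) / 2 ^ j" for j
  proof -
    have vj: "cmod (complex_of_real (v j)) < 1" using v by simp
    have "sqrt (kr (v j)) / 2 ^ j = a j * kr (v j)"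
      using kp[of j] by (simp add: a_def power_divide real_div_sqrt divide_simps)
    also have "\<dots> = (\<Sum>k\<in>{j}. Re (T k (of_real (v j))))"
      by (simp add: T_def K_diag)
    \<comment> \<open>K has nonnegative real part on the real diameter, so the other terms of the
      series cannot cancel the j-th one.\<close>
    also have "\<dots> \<le> (\<Sum>k. Re (T k (of_real (v j))))"
      using a(1) K_of_real_nonneg[OF v v]
      by (intro sum_le_suminf summable_Re sT vj) (auto simp: T_def less_imp_le)
    also have "\<dots> = Re (f (of_real (v j)))"
      using Re_suminf[OF sT[OF vj]] vj by (simp add: f_def)
    also have "\<dots> \<le> cmod (f (of_real (v j)))" by (rule complex_Re_le_cmod)
    finally show ?thesis .
  qed
  ultimately show thesis by (rule that)
qed

lemma M_crossing_limit:
  assumes \<phi>: "\<phi> \<in> M" and v: "\<And>k. \<bar>v k\<bar> < 1" and large: "\<And>k::nat. kr (v k) \<ge> 256 ^ k"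
  shows "(\<lambda>k. \<phi> (of_real (v k)) - \<phi> (- of_real (v k))) \<longlonglongrightarrow> 0"
proof -
  obtain f where f: "f \<in> H" and f_ge: "\<And>k. cmod (f (of_real (v k))) \<ge> sqrt (kr (v k)) / 2 ^ k"
    by (rule H_large_function[of v, OF v]) (use that in blast)
  have \<phi>f: "(\<lambda>z. \<phi> z * f z) \<in> H"
    using \<phi> f unfolding mult_alg_def by (rule multipliersD)
  have \<phi>\<phi>: "(\<lambda>z. \<phi> z * \<phi> z) \<in> H"
    using \<phi> by (intro M_subset_H) (simp add: mult_alg_def multipliers_mult)
  obtain A where A: "A > 0" "\<And>t. \<bar>t\<bar> < 1 \<Longrightarrow>
      (cmod (\<phi> (of_real t) * f (of_real t) - \<phi> (- of_real t) * f (- of_real t)))\<^sup>2 \<le> A"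
    by (rule H_pointwise_bounds[OF \<phi>f]) (use that in blast)
  obtain B where B: "B > 0" "\<And>t. \<bar>t\<bar> < 1 \<Longrightarrow> (cmod (f (of_real t) - f (- of_real t)))\<^sup>2 \<le> B"
    by (rule H_pointwise_bounds[OF f]) (use that in blast)
  obtain C where C: "C > 0" "\<And>t. \<bar>t\<bar> < 1 \<Longrightarrow> (cmod (\<phi> (- of_real t) * \<phi> (- of_real t)))\<^sup>2 \<le> C * kr t"
    by (rule H_pointwise_bounds[OF \<phi>\<phi>]) (use that in blast)
  define D where "D = sqrt A + sqrt (sqrt C) * sqrt B"
  have "cmod (\<phi> (of_real (v k)) - \<phi> (- of_real (v k))) \<le> D * (1 / 2) ^ k" for k
  proof -
    define z where "z = complex_of_real (v k)"
    \<comment> \<open>The fourth root of kr. The estimate leaves 2^k / s, and 256 = 4^4 makes s at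
      least 4^k, so that this tends to 0.\<close>
    define s where "s = sqrt (sqrt (kr (v k)))"
    have kp: "kr (v k) \<ge> 1" using kr_ge_one[OF v] .
    have s2: "s\<^sup>2 = sqrt (kr (v k))" using kp by (simp add: s_def)
    have "sqrt (sqrt (256 ^ k)) \<le> s" unfolding s_def using large by simp
    moreover have "(256::real) ^ k = ((4 ^ k)\<^sup>2)\<^sup>2" by (simp flip: power_mult power_mult_distrib) (simp add: power_mult)
    moreover have "sqrt (sqrt ((a\<^sup>2)\<^sup>2)) = a" if "a \<ge> 0" for a :: real
      using that by (simp only: real_sqrt_abs abs_power2 abs_of_nonneg)
    ultimately have s4: "s \<ge> 4 ^ k" by simp
    have s1: "s \<ge> 1" using kp by (simp add: s_def)
    have a: "cmod (\<phi> z * f z - \<phi> (- z) * f (- z)) \<le> sqrt A"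
      using A(2)[OF v[of k]] by (simp add: z_def real_le_rsqrt)
    have b: "cmod (f z - f (- z)) \<le> sqrt B"
      using B(2)[OF v[of k]] by (simp add: z_def real_le_rsqrt)
    have c: "cmod (\<phi> (- z)) \<le> sqrt (sqrt C) * s"
    proof -
      have "(cmod (\<phi> (- z)))\<^sup>2 \<le> sqrt (C * kr (v k))"
        using C(2)[OF v[of k]] by (intro real_le_rsqrt) (simp add: z_def norm_mult power2_eq_square)
      then have "cmod (\<phi> (- z)) \<le> sqrt (sqrt (C * kr (v k)))" by (rule real_le_rsqrt)
      then show ?thesis by (simp add: real_sqrt_mult s_def)
    qed
    have "cmod (\<phi> z - \<phi> (- z)) * (s\<^sup>2 / 2 ^ k) \<le> cmod (\<phi> z - \<phi> (- z)) * cmod (f z)"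
      using f_ge[of k] by (intro mult_left_mono) (auto simp: s2 z_def)
    also have "\<dots> = cmod ((\<phi> z * f z - \<phi> (- z) * f (- z)) - \<phi> (- z) * (f z - f (- z)))"
      by (simp add: algebra_simps flip: norm_mult)
    also have "\<dots> \<le> sqrt A + (sqrt (sqrt C) * s) * sqrt B"
    proof -
      have "0 \<le> sqrt (sqrt C) * s" using C(1) s1 by simp
      from mult_mono[OF c b this] have "cmod (\<phi> (- z) * (f z - f (- z))) \<le> (sqrt (sqrt C) * s) * sqrt B"
        by (simp add: norm_mult)
      then show ?thesis
        using a norm_triangle_ineq4[of "\<phi> z * f z - \<phi> (- z) * f (- z)" "\<phi> (- z) * (f z - f (- z))"]
        by linarith
    qed
    also have "\<dots> \<le> D * s"
      using s1 A(1) mult_left_mono[of 1 s "sqrt A"] by (simp add: D_def algebra_simps)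
    finally have "cmod (\<phi> z - \<phi> (- z)) * (s * s) \<le> D * 2 ^ k * s"
      by (simp add: field_simps power2_eq_square)
    then have "cmod (\<phi> z - \<phi> (- z)) * s \<le> D * 2 ^ k"
      using s1 by (simp add: mult.assoc[symmetric])
    moreover have "cmod (\<phi> z - \<phi> (- z)) * 4 ^ k \<le> cmod (\<phi> z - \<phi> (- z)) * s"
      using s4 by (intro mult_left_mono) auto
    ultimately have "cmod (\<phi> z - \<phi> (- z)) * 4 ^ k \<le> D * 2 ^ k" by linarith
    moreover have "(4::real) ^ k = 2 ^ k * 2 ^ k" by (simp flip: power_mult_distrib)
    ultimately have "(cmod (\<phi> z - \<phi> (- z)) * 2 ^ k) * 2 ^ k \<le> D * 2 ^ k" by (simp add: mult.assoc)
    then have "cmod (\<phi> z - \<phi> (- z)) * 2 ^ k \<le> D" by simp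
    then show ?thesis by (simp add: z_def field_simps)
  qed
  moreover have "(\<lambda>k. D * (1 / 2) ^ k) \<longlonglongrightarrow> 0"
    by (intro tendsto_mult_right_zero LIMSEQ_realpow_zero) auto
  ultimately show ?thesis
    by (rule Lim_null_comparison[OF always_eventually[rule_format]])
qed

lemma crossing_sequence:
  obtains v :: "nat \<Rightarrow> real" where "\<And>k. \<bar>v k\<bar> < 1" "\<And>k. kr (v k) \<ge> 256 ^ k" "v \<longlonglongrightarrow> 1"
proof -
  have nz: "1 - r \<noteq> 0" "1 + r \<noteq> 0" using r_gt r_less by auto
  have lim: "((\<lambda>t. 1 - ((Xr t)\<^sup>2 + (Yr t)\<^sup>2) / 2) \<longlongrightarrow> 0) (at_left 1)"
    unfolding Xr_def Yr_def
    by (rule tendsto_eq_intros refl | use nz in simp)+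
  have ev1: "eventually (\<lambda>t. \<bar>t\<bar> < 1 \<and> 1 - 1 / real (Suc k) < t) (at_left (1::real))" for k
  proof -
    have *: "1 - 1 / real (Suc k) < 1" "- 1 < (1::real)" by simp_all
    show ?thesis
      using eventually_at_left_real[OF *(1)] eventually_at_left_real[OF *(2)]
      by eventually_elim auto
  qed
  have "\<exists>t. \<bar>t\<bar> < 1 \<and> 1 - 1 / real (Suc k) < t \<and> kr t \<ge> 256 ^ k" for k
  proof -
    have "eventually (\<lambda>t. 1 - ((Xr t)\<^sup>2 + (Yr t)\<^sup>2) / 2 < 1 / 256 ^ k) (at_left 1)"
      by (rule order_tendstoD(2)[OF lim]) simp
    with ev1[of k] have "eventually (\<lambda>t. \<bar>t\<bar> < 1 \<and> 1 - 1 / real (Suc k) < t \<and> kr t \<ge> 256 ^ k) (at_left 1)"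
    proof eventually_elim
      case (elim t)
      define e where "e = 1 - ((Xr t)\<^sup>2 + (Yr t)\<^sup>2) / 2"
      have "1 / e \<ge> 1" using kr_ge_one[of t] elim by (simp add: kr_def e_def)
      then have "e > 0" by (cases "e > 0") (auto simp: divide_simps split: if_splits)
      moreover have "e < 1 / 256 ^ k" using elim by (simp add: e_def)
      ultimately have "kr t \<ge> 256 ^ k" by (simp add: kr_def e_def[symmetric] field_simps)
      then show ?case using elim by simp
    qed
    then show ?thesis using eventually_happens'[of "at_left (1::real)"] trivial_limit_at_left_real by blast
  qed
  then obtain v where v: "\<And>k. \<bar>v k\<bar> < 1" "\<And>k. 1 - 1 / real (Suc k) < v k" "\<And>k. kr (v k) \<ge> 256 ^ k"
    by metis
  have "v \<longlonglongrightarrow> 1"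
  proof (rule tendsto_sandwich[OF _ _ _ tendsto_const])
    show "(\<lambda>k. 1 - 1 / real (Suc k)) \<longlonglongrightarrow> 1"
      using tendsto_diff[OF tendsto_const[of 1] LIMSEQ_inverse_real_of_nat] by (simp add: inverse_eq_divide)
    show "\<forall>\<^sub>F k in sequentially. 1 - 1 / real (Suc k) \<le> v k"
      using v(2) by (intro always_eventually allI less_imp_le)
    show "\<forall>\<^sub>F k in sequentially. v k \<le> 1"
      using v(1) by (intro always_eventually allI) (simp add: abs_less_iff less_imp_le)
  qed
  then show thesis using that v by blast
qed

end

section \<open>Rigidity\<close>

context crossing_disc
begin

lemma H_reflect:
  assumes f: "f \<in> H" shows "(\<lambda>z. f (- z)) \<in> H"
proof -
  obtain C where C: "C > 0"
    and pos: "pos_kernel unit_disc (\<lambda>z w. complex_of_real C * K z w - f z * cnj (f w))"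
    using rkhsE[OF f pos_kernel_K] by blast
  have "pos_kernel unit_disc (\<lambda>z w. complex_of_real C * K z w - f (- z) * cnj (f (- w)))"
    using pos_kernel_pullback[OF pos, of unit_disc uminus] by (simp add: K_minus_minus)
  then show ?thesis
    using C f by (intro rkhsI[of _ _ C]) (auto simp: rkhs_outside)
qed

lemma M_reflect:
  assumes \<phi>: "\<phi> \<in> M" shows "(\<lambda>z. \<phi> (- z)) \<in> M"
  unfolding mult_alg_def multipliers_def mem_Collect_eq
proof (intro conjI allI impI ballI)
  fix z :: complex assume "z \<notin> unit_disc"
  then show "\<phi> (- z) = 0"
    using multipliers_outside[OF \<phi>[unfolded mult_alg_def], of "- z"] by simp
next
  fix f assume "f \<in> H"
  from H_reflect[OF multipliersD[OF \<phi>[unfolded mult_alg_def] H_reflect[OF this]]]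
  show "(\<lambda>z. \<phi> (- z) * f z) \<in> H" by simp
qed

text \<open>If \<open>X\<close> and \<open>Y\<close> agree at p and q, then q is the image of p under the elliptic
  involutions of the disc fixing r and fixing -r, and their only common two-point orbit
  is \<open>{1, -1}\<close>.\<close>

lemma boundary_crossing:
  fixes p q :: complex
  assumes pq: "cmod p \<le> 1" "cmod q \<le> 1" "p \<noteq> q" and X: "X p = X q" and Y: "Y p = Y q"
  shows "q = - p" "p = 1 \<or> p = -1"
proof -
  have nz: "1 - \<rho> * p \<noteq> 0" "1 + \<rho> * p \<noteq> 0" "1 - \<rho> * q \<noteq> 0" "1 + \<rho> * q \<noteq> 0"
    using denominator_nonzero pq by auto
  have r2: "1 - \<rho>\<^sup>2 \<noteq> 0" "\<rho> \<noteq> 0" "1 + \<rho>\<^sup>2 \<noteq> 0"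
  proof -
    have *: "1 - \<rho>\<^sup>2 = complex_of_real (2 * \<kappa>)" "1 + \<rho>\<^sup>2 = complex_of_real (1 + r\<^sup>2)"
      by (simp_all add: \<kappa>_def)
    have "1 + r\<^sup>2 > 0" by (simp add: add_pos_nonneg)
    then show "1 - \<rho>\<^sup>2 \<noteq> 0" "1 + \<rho>\<^sup>2 \<noteq> 0" unfolding * of_real_eq_0_iff using \<kappa>_pos by linarith+
  qed (use r_less in simp)
  have x: "x p * (1 - \<rho> * p) = p - \<rho>" "x q * (1 - \<rho> * q) = q - \<rho>"
    and y: "y p * (1 + \<rho> * p) = p + \<rho>" "y q * (1 + \<rho> * q) = q + \<rho>"
    using nz by (simp_all add: x_def' y_def')
  have "x p \<noteq> x q"
  proof
    assume "x p = x q"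
    with x have "(p - q) * (1 - \<rho>\<^sup>2) = 0" by algebra
    then show False using pq r2 by simp
  qed
  moreover have "y p \<noteq> y q"
  proof
    assume "y p = y q"
    with y have "(p - q) * (1 - \<rho>\<^sup>2) = 0" by algebra
    then show False using pq r2 by simp
  qed
  ultimately have "x p = - x q" "y p = - y q"
    using X Y by (auto simp: X_def Y_def power2_eq_iff)
  with x y have "(1 + \<rho>\<^sup>2) * (p + q) - 2 * \<rho> * (1 + p * q) = 0"
    "(1 + \<rho>\<^sup>2) * (p + q) + 2 * \<rho> * (1 + p * q) = 0" by algebra+
  then have "2 * ((1 + \<rho>\<^sup>2) * (p + q)) = 0" "4 * \<rho> * (1 + p * q) = 0" by algebra+
  then have "p + q = 0" "1 + p * q = 0" using r2 by auto
  then show "q = - p" and "p = 1 \<or> p = -1"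
    by (auto simp: eq_neg_iff_add_eq_0 add.commute) algebra
qed

text \<open>\<open>exp (\<i> \<tau> ln (1 - g))\<close> oscillates at the crossing, and \<open>1 - g\<close> decays at the same
  rate along both sheets. A hyperbolic translation changes the two rates by reciprocal
  factors, and \<open>\<tau>\<close> is chosen to make the resulting phases opposite.\<close>

lemma oscillating_multiplier:
  assumes \<alpha>: "\<bar>\<alpha>\<bar> < 1" "\<alpha> \<noteq> 0"
  defines "\<beta> \<equiv> \<lambda>t. (t - \<alpha>) / (1 - \<alpha> * t)"
  obtains \<phi> where "\<phi> \<in> M" "\<And>z. \<phi> (- z) = \<phi> z"
    "\<And>v::nat \<Rightarrow> real. (\<And>k. \<bar>v k\<bar> < 1) \<Longrightarrow> v \<longlonglongrightarrow> 1 \<Longrightarrow>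
       (\<lambda>k. cmod (\<phi> (of_real (\<beta> (v k))) - \<phi> (of_real (\<beta> (- v k))))) \<longlonglongrightarrow> 2"
proof -
  \<comment> \<open>L is the limit, as t tends to 1, of the difference of ln (1 - g) at \<beta> t
    and at \<beta> (- t). The choice \<tau> * L = pi turns the relative phase into -1, and two
    opposite unit numbers have distance 2.\<close>
  define L where "L = ln (((1 + \<alpha>) / (1 - \<alpha>))\<^sup>2)"
  define \<tau> where "\<tau> = pi / L"
  have base: "(1 + \<alpha>) / (1 - \<alpha>) > 0" "(1 + \<alpha>) / (1 - \<alpha>) \<noteq> 1"
    using \<alpha> by (auto simp: divide_simps)
  then have L: "L \<noteq> 0" by (simp add: L_def ln_realpow)
  define \<psi> where "\<psi> u = exp (\<i> * of_real \<tau> * Ln (1 - u))" for u :: complex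
  define \<phi> where "\<phi> = cut (\<lambda>z. \<psi> (g z))"
  have h\<psi>: "\<psi> holomorphic_on unit_disc"
    unfolding \<psi>_def
  proof (intro holomorphic_intros)
    fix u assume "u \<in> unit_disc"
    then have "0 < Re (1 - u)" using complex_Re_le_cmod[of u] by simp
    then show "1 - u \<notin> \<real>\<^sub>\<le>\<^sub>0" by (auto simp: complex_nonpos_Reals_iff)
  qed
  \<comment> \<open>The modulus of \<psi> depends only on the argument of 1 - u, so \<psi> is
    bounded although it oscillates at 1.\<close>
  have b\<psi>: "cmod (\<psi> u) \<le> exp (\<bar>\<tau>\<bar> * pi)" if "cmod u < 1" for u
  proof -
    have "1 - u \<noteq> 0" using that by auto
    then have "\<bar>Im (Ln (1 - u))\<bar> \<le> pi" using mpi_less_Im_Ln Im_Ln_le_pi by (simp add: abs_le_iff less_imp_le minus_le_iff)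
    then have "\<bar>\<tau> * Im (Ln (1 - u))\<bar> \<le> \<bar>\<tau>\<bar> * pi" by (simp add: abs_mult mult_left_mono)
    then show ?thesis by (simp add: \<psi>_def abs_le_iff)
  qed
  have \<phi>M: "\<phi> \<in> M"
    unfolding \<phi>_def by (rule M_cut[OF bounded_multiplier_compose_g[OF h\<psi> b\<psi>]])
  have even: "\<phi> (- z) = \<phi> z" for z
    by (simp add: \<phi>_def cut_def g_def X_minus Y_minus add.commute)
  define E where "E t = (1 + r\<^sup>2 * t\<^sup>2) / (1 - r\<^sup>2 * t\<^sup>2)\<^sup>2" for t :: real
  define h where "h t = (1 - r\<^sup>2) * (1 - t\<^sup>2) * E t" for t :: real
  have r2: "0 < 1 - r\<^sup>2" using \<kappa>_pos by (simp add: \<kappa>_def)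
  have rt: "0 < 1 - r\<^sup>2 * t\<^sup>2" if "\<bar>t\<bar> \<le> 1" for t
  proof -
    have "r\<^sup>2 * t\<^sup>2 \<le> r\<^sup>2 * 1" using that by (intro mult_left_mono) (auto simp: abs_square_le_1)
    then show ?thesis using r2 by simp
  qed
  have E_pos: "E t > 0" if "\<bar>t\<bar> \<le> 1" for t
    using rt[OF that] by (auto simp: E_def intro!: divide_pos_pos add_pos_nonneg)
  have h_pos: "h t > 0" if "\<bar>t\<bar> < 1" for t
    using r2 E_pos[of t] that by (simp add: h_def abs_square_less_1)
  have g_h: "1 - g (of_real t) = of_real (h t)" if "\<bar>t\<bar> < 1" for t
  proof -
    have "(1 - \<rho> * of_real t) * (1 + \<rho> * of_real t) = 1 - \<rho>\<^sup>2 * (of_real t)\<^sup>2" by algebra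
    then show ?thesis using one_minus_g[of "of_real t"] that by (simp add: h_def E_def)
  qed
  have \<phi>_real: "\<phi> (of_real t) = exp (\<i> * of_real (\<tau> * ln (h t)))" if "\<bar>t\<bar> < 1" for t
    using that h_pos[OF that] by (simp add: \<phi>_def \<psi>_def g_h Ln_of_real mult.assoc)
  have \<alpha>t: "0 < 1 - \<alpha> * t" if "\<bar>t\<bar> \<le> 1" for t
  proof -
    have "\<bar>\<alpha> * t\<bar> \<le> \<bar>\<alpha>\<bar>" using that by (simp add: abs_mult mult_left_le)
    then show ?thesis using \<alpha>(1) by linarith
  qed
  have \<beta>2: "1 - (\<beta> t)\<^sup>2 = (1 - \<alpha>\<^sup>2) * (1 - t\<^sup>2) / (1 - \<alpha> * t)\<^sup>2" if "\<bar>t\<bar> < 1" for t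
  proof -
    have quot: "1 - (u / v)\<^sup>2 = (v\<^sup>2 - u\<^sup>2) / v\<^sup>2" if "v \<noteq> 0" for u v :: real
      using that by (simp add: power_divide diff_divide_distrib)
    have "1 - (\<beta> t)\<^sup>2 = ((1 - \<alpha> * t)\<^sup>2 - (t - \<alpha>)\<^sup>2) / (1 - \<alpha> * t)\<^sup>2"
      unfolding \<beta>_def by (rule quot) (use \<alpha>t[of t] that in simp)
    also have "(1 - \<alpha> * t)\<^sup>2 - (t - \<alpha>)\<^sup>2 = (1 - \<alpha>\<^sup>2) * (1 - t\<^sup>2)" by algebra
    finally show ?thesis .
  qed
  have a2: "0 < 1 - \<alpha>\<^sup>2" using \<alpha> by (simp add: abs_square_less_1)
  have \<beta>1: "\<bar>\<beta> t\<bar> < 1" if t: "\<bar>t\<bar> < 1" for t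
  proof -
    have "0 < 1 - (\<beta> t)\<^sup>2"
      unfolding \<beta>2[OF t] using a2 t \<alpha>t[of t] by (auto simp: abs_square_less_1 intro!: divide_pos_pos mult_pos_pos)
    then show ?thesis by (simp add: abs_square_less_1)
  qed
  \<comment> \<open>The ratio of h at \<beta> t and \<beta> (- t); the square comes from the
    denominators in \<open>\<beta>2\<close>.\<close>
  define Q where "Q t = ((1 + \<alpha> * t) / (1 - \<alpha> * t))\<^sup>2 * (E (\<beta> t) / E (\<beta> (- t)))" for t
  have Q: "Q t > 0" "ln (h (\<beta> t)) - ln (h (\<beta> (- t))) = ln (Q t)" if t: "\<bar>t\<bar> < 1" for t
  proof -
    have nt: "\<bar>- t\<bar> < 1" using t by simp
    have d: "1 - \<alpha> * t > 0" "1 + \<alpha> * t > 0" using \<alpha>t[of t] \<alpha>t[of "- t"] t by auto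
    have Ep: "E (\<beta> t) > 0" "E (\<beta> (- t)) > 0" using E_pos \<beta>1[OF t] \<beta>1[OF nt] by (auto simp: less_imp_le)
    have "h (\<beta> t) / h (\<beta> (- t)) = ((1 - (\<beta> t)\<^sup>2) / (1 - (\<beta> (- t))\<^sup>2)) * (E (\<beta> t) / E (\<beta> (- t)))"
      using r2 by (simp add: h_def)
    also have "(1 - (\<beta> t)\<^sup>2) / (1 - (\<beta> (- t))\<^sup>2) = ((1 + \<alpha> * t) / (1 - \<alpha> * t))\<^sup>2"
      unfolding \<beta>2[OF t] \<beta>2[OF nt] using \<alpha>(1) t d by (simp add: power_divide abs_square_eq_1)
    finally have "h (\<beta> t) / h (\<beta> (- t)) = Q t" by (simp add: Q_def)
    then show "ln (h (\<beta> t)) - ln (h (\<beta> (- t))) = ln (Q t)"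
      using h_pos[OF \<beta>1[OF t]] h_pos[OF \<beta>1[OF nt]] ln_div[of "h (\<beta> t)" "h (\<beta> (- t))"] by simp
    show "Q t > 0" unfolding Q_def using d Ep by (intro mult_pos_pos divide_pos_pos zero_less_power) auto
  qed
  have "(\<lambda>k. cmod (\<phi> (of_real (\<beta> (v k))) - \<phi> (of_real (\<beta> (- v k))))) \<longlonglongrightarrow> 2"
    if v: "\<And>k. \<bar>v k\<bar> < 1" "v \<longlonglongrightarrow> 1" for v :: "nat \<Rightarrow> real"
  proof -
    have n1: "1 - \<alpha> \<noteq> 0" "1 + \<alpha> \<noteq> 0" using \<alpha> by auto
    have l1: "(\<lambda>k. \<beta> (v k)) \<longlonglongrightarrow> 1" and l2: "(\<lambda>k. \<beta> (- v k)) \<longlonglongrightarrow> -1"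
      unfolding \<beta>_def by (rule tendsto_eq_intros v(2) refl | use n1 in \<open>simp add: divide_eq_minus_1_iff\<close>)+
    have rn: "1 - r\<^sup>2 \<noteq> 0" using r2 by simp
    have E1: "(\<lambda>k. E (\<beta> (v k))) \<longlonglongrightarrow> E 1" and E2: "(\<lambda>k. E (\<beta> (- v k))) \<longlonglongrightarrow> E 1"
      unfolding E_def by (rule tendsto_eq_intros l1 l2 refl | use rn in simp)+
    have "(\<lambda>k. Q (v k)) \<longlonglongrightarrow> ((1 + \<alpha> * 1) / (1 - \<alpha> * 1))\<^sup>2 * (E 1 / E 1)"
      unfolding Q_def by (intro tendsto_intros v(2) E1 E2) (use n1 E_pos[of 1] in auto)
    then have "(\<lambda>k. ln (Q (v k))) \<longlonglongrightarrow> L"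
      unfolding L_def using base E_pos[of 1] by (intro tendsto_ln) auto
    then have "(\<lambda>k. cmod (exp (\<i> * of_real (\<tau> * ln (Q (v k)))) - 1)) \<longlonglongrightarrow> cmod (exp (\<i> * of_real (\<tau> * L)) - 1)"
      by (intro tendsto_intros)
    moreover have "\<tau> * L = pi" using L by (simp add: \<tau>_def)
    moreover have "cmod (exp (\<i> * of_real pi) - 1) = 2" using exp_pi_i' by simp
    moreover have "cmod (\<phi> (of_real (\<beta> (v k))) - \<phi> (of_real (\<beta> (- v k)))) =
        cmod (exp (\<i> * of_real (\<tau> * ln (Q (v k)))) - 1)" for k
    proof -
      have nv: "\<bar>- v k\<bar> < 1" using v(1) by simp
      define l1 l2 where "l1 = \<tau> * ln (h (\<beta> (v k)))" and "l2 = \<tau> * ln (h (\<beta> (- v k)))"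
      have "l1 = l2 + \<tau> * ln (Q (v k))"
        using Q(2)[OF v(1)[of k]] by (simp add: l1_def l2_def algebra_simps flip: Q(2)[OF v(1)[of k]])
      then have "exp (\<i> * of_real l1) - exp (\<i> * of_real l2)
          = exp (\<i> * of_real l2) * (exp (\<i> * of_real (\<tau> * ln (Q (v k)))) - 1)"
        by (simp add: algebra_simps exp_add)
      then show ?thesis
        using \<phi>_real[OF \<beta>1[OF v(1)[of k]]] \<phi>_real[OF \<beta>1[OF nv]]
        by (simp add: norm_mult flip: l1_def l2_def)
    qed
    ultimately show ?thesis by simp
  qed
  then show thesis using that[OF \<phi>M even] by blast
qed

end

text \<open>A form with both parameters visible, applied once to the isomorphism and once to its
  inverse.\<close>

lemma homomorphism_composition:
  assumes r: "crossing_disc r" and s: "crossing_disc s"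
    and into: "\<And>a. a \<in> mult_alg (f_map r) \<Longrightarrow> \<Phi> a \<in> mult_alg (f_map s)"
    and inj: "inj_on \<Phi> (mult_alg (f_map r))"
    and add: "\<And>a b. a \<in> mult_alg (f_map r) \<Longrightarrow> b \<in> mult_alg (f_map r) \<Longrightarrow>
        \<Phi> (\<lambda>z. a z + b z) = (\<lambda>z. \<Phi> a z + \<Phi> b z)"
    and mult: "\<And>a b. a \<in> mult_alg (f_map r) \<Longrightarrow> b \<in> mult_alg (f_map r) \<Longrightarrow>
        \<Phi> (\<lambda>z. a z * b z) = (\<lambda>z. \<Phi> a z * \<Phi> b z)"
    and scale: "\<And>a c. a \<in> mult_alg (f_map r) \<Longrightarrow> \<Phi> (\<lambda>z. c * a z) = (\<lambda>z. c * \<Phi> a z)"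
    and one: "\<Phi> (cut (\<lambda>_. 1)) = cut (\<lambda>_. 1)"
  obtains F where "F holomorphic_on unit_disc" "\<And>w. cmod w < 1 \<Longrightarrow> cmod (F w) < 1"
    "\<And>\<phi> w. \<phi> \<in> mult_alg (f_map r) \<Longrightarrow> cmod w < 1 \<Longrightarrow> \<Phi> \<phi> w = \<phi> (F w)"
proof -
  interpret R: crossing_disc r by (rule r)
  interpret S: crossing_disc s by (rule s)
  show thesis
  proof (rule R.homomorphism_is_composition)
    show "\<Phi> a holomorphic_on unit_disc" if "a \<in> R.M" for a
      by (rule S.M_holomorphic[OF into[OF that]])
    show "R.character (\<lambda>a. \<Phi> a w)" if "cmod w < 1" for w
      using that by (simp add: R.character_def add mult scale one)
    show "a = b" if ab: "a \<in> R.M" "b \<in> R.M" "\<And>w. cmod w < 1 \<Longrightarrow> \<Phi> a w = \<Phi> b w" for a b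
    proof (rule inj_onD[OF inj _ ab(1,2)], rule ext)
      fix w show "\<Phi> a w = \<Phi> b w"
        using ab(3)[of w] into[OF ab(1)] into[OF ab(2)]
        by (cases "w \<in> unit_disc") (auto simp: mult_alg_def multipliers_outside)
    qed
  qed (rule that)
qed

text \<open>By assumption \<phi> composed with F is a multiplier for s, so the crossing limit for s
  becomes a condition on \<phi> at the images under F of points near 1 and -1.\<close>

lemma crossing_preserving_automorphism:
  assumes r: "crossing_disc r" and s: "crossing_disc s"
    and c: "cmod c = 1" and a: "cmod a < 1"
    and F: "\<And>z. cmod z < 1 \<Longrightarrow> F z = c * (z - a) / (1 - cnj a * z)"
    and M: "\<And>\<phi>. \<phi> \<in> mult_alg (f_map r) \<Longrightarrow> \<exists>\<psi>\<in>mult_alg (f_map s). \<forall>w. cmod w < 1 \<longrightarrow> \<psi> w = \<phi> (F w)"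
  shows "(\<forall>z. cmod z < 1 \<longrightarrow> F z = z) \<or> (\<forall>z. cmod z < 1 \<longrightarrow> F z = - z)"
proof -
  interpret R: crossing_disc r by (rule r)
  interpret S: crossing_disc s by (rule s)
  obtain v where v: "\<And>k. \<bar>v k\<bar> < 1" "\<And>k. S.kr (v k) \<ge> 256 ^ k" "v \<longlonglongrightarrow> 1"
    by (rule S.crossing_sequence) (use that in blast)
  have lim: "(\<lambda>k. \<phi> (F (of_real (v k))) - \<phi> (F (- of_real (v k)))) \<longlonglongrightarrow> 0" if \<phi>: "\<phi> \<in> R.M" for \<phi>
  proof -
    obtain \<psi> where \<psi>: "\<psi> \<in> S.M" "\<And>w. cmod w < 1 \<Longrightarrow> \<psi> w = \<phi> (F w)" using M[OF \<phi>] by blast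
    have "(\<lambda>k. \<psi> (of_real (v k)) - \<psi> (- of_real (v k))) \<longlonglongrightarrow> 0"
      by (rule S.M_crossing_limit[OF \<psi>(1) v(1,2)])
    then show ?thesis using v(1) by (simp add: \<psi>(2))
  qed
  \<comment> \<open>T continues F to the boundary points 1 and -1, where F itself is not
    constrained.\<close>
  define T where "T z = c * (z - a) / (1 - cnj a * z)" for z
  have nz: "1 - cnj a \<noteq> 0" "1 + cnj a \<noteq> 0"
    using one_minus_mult_cnj_nonzero(2)[of 1 a] one_minus_mult_cnj_nonzero(2)[of "-1" a] a by auto
  have F_in: "cmod (F z) < 1" if "cmod z < 1" for z
    using Moebius_function_norm_lt_1[OF a that, of 0] c
    by (simp add: F[OF that] norm_divide norm_mult Moebius_function_simple)
  have Ft: "(\<lambda>k. F (of_real (v k))) \<longlonglongrightarrow> T 1" "(\<lambda>k. F (- of_real (v k))) \<longlonglongrightarrow> T (-1)"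
  proof -
    have "(\<lambda>k. T (of_real (v k))) \<longlonglongrightarrow> T (of_real 1)" "(\<lambda>k. T (- of_real (v k))) \<longlonglongrightarrow> T (- of_real 1)"
      unfolding T_def by (intro tendsto_intros v(3); use nz in simp)+
    then show "(\<lambda>k. F (of_real (v k))) \<longlonglongrightarrow> T 1" "(\<lambda>k. F (- of_real (v k))) \<longlonglongrightarrow> T (-1)"
      using v(1) by (simp_all add: F T_def)
  qed
  have cT: "cmod (T 1) \<le> 1" "cmod (T (-1)) \<le> 1"
    using F_in v(1) by (intro tendsto_upperbound[OF tendsto_norm[OF Ft(1)]] tendsto_upperbound[OF tendsto_norm[OF Ft(2)]];
        simp add: less_imp_le)+
  have eq: "p (T 1) = p (T (-1))" if hol: "p holomorphic_on cball 0 1" and bm: "bounded_multiplier unit_disc R.K p" for p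
  proof -
    have co: "continuous_on (cball 0 1) p" by (rule holomorphic_on_imp_continuous_on[OF hol])
    have "(\<lambda>k. p (F (of_real (v k)))) \<longlonglongrightarrow> p (T 1)" "(\<lambda>k. p (F (- of_real (v k)))) \<longlonglongrightarrow> p (T (-1))"
      using F_in v(1) cT
      by (auto intro!: continuous_on_tendsto_compose[OF co Ft(1)] continuous_on_tendsto_compose[OF co Ft(2)] simp: less_imp_le)
    from tendsto_diff[OF this]
    have "(\<lambda>k. p (F (of_real (v k))) - p (F (- of_real (v k)))) \<longlonglongrightarrow> p (T 1) - p (T (-1))" .
    moreover have "(\<lambda>k. p (F (of_real (v k))) - p (F (- of_real (v k)))) \<longlonglongrightarrow> 0"
      using lim[OF R.M_cut[OF bm]] F_in v(1) by simp
    ultimately show ?thesis using LIMSEQ_unique by fastforce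
  qed
  have "T 1 \<noteq> T (-1)"
  proof
    assume "T 1 = T (-1)"
    then have "(1 - a) * (1 + cnj a) = - (1 + a) * (1 - cnj a)"
      using c nz by (auto simp: T_def field_simps)
    then have "1 - a * cnj a = 0" by algebra
    then show False using one_minus_mult_cnj_nonzero[of a a] a by simp
  qed
  then have TT: "T (-1) = - T 1" "T 1 = 1 \<or> T 1 = -1"
    using R.boundary_crossing[OF cT] eq[OF R.holomorphic_X R.bounded_multiplier_X]
      eq[OF R.holomorphic_Y R.bounded_multiplier_Y] by auto
  define \<sigma> where "\<sigma> = T 1"
  have \<sigma>: "\<sigma> = 1 \<or> \<sigma> = -1" using TT by (simp add: \<sigma>_def)
  \<comment> \<open>Adding this and the next equation gives c = \<sigma>, subtracting them gives
    that a is real.\<close>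
  have "c * (1 - a) = \<sigma> * (1 - cnj a)" using nz by (simp add: \<sigma>_def T_def)
  moreover have "c * (1 + a) = \<sigma> * (1 + cnj a)"
  proof -
    have "T (-1) * (1 + cnj a) = c * (-1 - a)" using nz by (simp add: T_def)
    then have "T (-1) * (1 + cnj a) = - (c * (1 + a))" by algebra
    then show ?thesis unfolding TT(1) \<sigma>_def[symmetric] by simp
  qed
  ultimately have "2 * c = 2 * \<sigma>" "c * (2 * a) = \<sigma> * (2 * cnj a)" by algebra+
  then have c\<sigma>: "c = \<sigma>" and "a = cnj a" using c by auto
  then obtain \<alpha> where \<alpha>: "a = of_real \<alpha>" by (metis complex_is_Real_iff Reals_cases complex_cnj_cancel_iff Reals_cnj_iff)
  have "\<alpha> = 0"
  proof (rule ccontr)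
    assume \<alpha>0: "\<alpha> \<noteq> 0"
    have a1: "\<bar>\<alpha>\<bar> < 1" using a \<alpha> by simp
    obtain \<phi> where \<phi>: "\<phi> \<in> R.M" "\<And>z. \<phi> (- z) = \<phi> z"
      and lim2: "\<And>v::nat \<Rightarrow> real. (\<And>k. \<bar>v k\<bar> < 1) \<Longrightarrow> v \<longlonglongrightarrow> 1 \<Longrightarrow>
       (\<lambda>k. cmod (\<phi> (of_real ((v k - \<alpha>) / (1 - \<alpha> * v k))) - \<phi> (of_real ((- v k - \<alpha>) / (1 - \<alpha> * - v k))))) \<longlonglongrightarrow> 2"
      by (rule R.oscillating_multiplier[OF a1 \<alpha>0]) (use that in blast)
    have "\<phi> (F (of_real t)) = \<phi> (of_real ((t - \<alpha>) / (1 - \<alpha> * t)))" if "\<bar>t\<bar> < 1" for t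
    proof -
      have e: "F (of_real t) = \<sigma> * of_real ((t - \<alpha>) / (1 - \<alpha> * t))"
        using F[of "of_real t"] that by (simp add: c\<sigma> \<alpha>)
      \<comment> \<open>\<phi> is even, so the sign \<sigma> has no effect.\<close>
      from \<sigma> show ?thesis
        unfolding e by (elim disjE) (simp_all only: mult_1 mult_minus1 \<phi>(2))
    qed
    from this[OF v(1)] this[of "- v k" for k] v(1)
    have "(\<lambda>k. cmod (\<phi> (F (of_real (v k))) - \<phi> (F (- of_real (v k))))) \<longlonglongrightarrow> 2"
      using lim2[OF v(1,3)] by simp
    with tendsto_norm[OF lim[OF \<phi>(1)]] show False using LIMSEQ_unique by fastforce
  qed
  then show ?thesis using F \<sigma> by (auto simp: \<alpha> c\<sigma>)
qed

theorem theorem1p7: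
  fixes r s :: real
  assumes "-1 < r" "r < 0" "-1 < s" "s < 0"
  shows "alg_isomorphic (mult_alg (f_map r)) (mult_alg (f_map s)) \<longleftrightarrow>
         mult_alg (f_map r) = mult_alg (f_map s)"
proof
  assume "mult_alg (f_map r) = mult_alg (f_map s)"
  then show "alg_isomorphic (mult_alg (f_map r)) (mult_alg (f_map s))"
    unfolding alg_isomorphic_def by (intro exI[of _ id]) auto
next
  assume "alg_isomorphic (mult_alg (f_map r)) (mult_alg (f_map s))"
  interpret R: crossing_disc r by unfold_locales (use assms in auto)
  interpret S: crossing_disc s by unfold_locales (use assms in auto)
  obtain \<Phi> where bij: "bij_betw \<Phi> R.M S.M"
    and add: "\<And>a b. a \<in> R.M \<Longrightarrow> b \<in> R.M \<Longrightarrow> \<Phi> (\<lambda>z. a z + b z) = (\<lambda>z. \<Phi> a z + \<Phi> b z)"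
    and mult: "\<And>a b. a \<in> R.M \<Longrightarrow> b \<in> R.M \<Longrightarrow> \<Phi> (\<lambda>z. a z * b z) = (\<lambda>z. \<Phi> a z * \<Phi> b z)"
    and scale: "\<And>a c. a \<in> R.M \<Longrightarrow> \<Phi> (\<lambda>z. c * a z) = (\<lambda>z. c * \<Phi> a z)"
    using \<open>alg_isomorphic R.M S.M\<close> unfolding alg_isomorphic_def by blast
  define \<Psi> where "\<Psi> = inv_into R.M \<Phi>"
  have inj: "inj_on \<Phi> R.M" and into: "\<And>a. a \<in> R.M \<Longrightarrow> \<Phi> a \<in> S.M"
    using bij by (auto simp: bij_betw_def)
  have bij': "bij_betw \<Psi> S.M R.M" unfolding \<Psi>_def by (rule bij_betw_inv_into[OF bij])
  have inj': "inj_on \<Psi> S.M" and into': "\<And>a. a \<in> S.M \<Longrightarrow> \<Psi> a \<in> R.M"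
    using bij' by (auto simp: bij_betw_def)
  have \<Phi>\<Psi>: "\<Phi> (\<Psi> b) = b" if "b \<in> S.M" for b
    unfolding \<Psi>_def by (rule bij_betw_inv_into_right[OF bij that])
  have \<Psi>\<Phi>: "\<Psi> (\<Phi> a) = a" if "a \<in> R.M" for a
    unfolding \<Psi>_def by (rule bij_betw_inv_into_left[OF bij that])
  have outside: "\<phi> z = 0" if "\<phi> \<in> mult_alg h" "\<not> cmod z < 1" for \<phi> h z
    using that multipliers_outside[of \<phi> unit_disc "kernel_h h" z] by (simp add: mult_alg_def)
  have closed: "(\<lambda>z. a z + b z) \<in> mult_alg h" "(\<lambda>z. a z * b z) \<in> mult_alg h"
    if "a \<in> mult_alg h" "b \<in> mult_alg h" for a b h
    using that by (auto simp: mult_alg_def intro: multipliers_add multipliers_mult)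
  have closed_scale: "(\<lambda>z. c * a z) \<in> mult_alg h" if "a \<in> mult_alg h" for a c h
    using that by (auto simp: mult_alg_def intro: multipliers_scale)
  have cut1: "(\<lambda>z. cut (\<lambda>_. 1) z * a z) = a" if "a \<in> mult_alg h" for a h
    using outside[OF that] by (auto simp: cut_def)
  have one: "\<Phi> (cut (\<lambda>_. 1)) = cut (\<lambda>_. 1)"
  proof -
    define e where "e = \<Psi> (cut (\<lambda>_. 1))"
    have e: "e \<in> R.M" "\<Phi> e = cut (\<lambda>_. 1)" by (auto simp: e_def into' \<Phi>\<Psi> S.M_one)
    have "\<Phi> (\<lambda>z. cut (\<lambda>_. 1) z * e z) = (\<lambda>z. \<Phi> (cut (\<lambda>_. 1)) z * \<Phi> e z)"
      by (rule mult[OF R.M_one e(1)])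
    then have "cut (\<lambda>_. 1) = (\<lambda>z. cut (\<lambda>_. 1) z * \<Phi> (cut (\<lambda>_. 1)) z)"
      unfolding cut1[OF e(1)] e(2) by (simp add: mult.commute)
    then show ?thesis using cut1[OF into[OF R.M_one]] by simp
  qed
  have one': "\<Psi> (cut (\<lambda>_. 1)) = cut (\<lambda>_. 1)" using \<Psi>\<Phi>[OF R.M_one] one by simp
  have lift: "\<Psi> b = a" if "\<Phi> a = b" "a \<in> R.M" for a b using \<Psi>\<Phi> that by auto
  obtain F where F: "F holomorphic_on unit_disc" "\<And>w. cmod w < 1 \<Longrightarrow> cmod (F w) < 1"
    and \<Phi>F: "\<And>\<phi> w. \<phi> \<in> R.M \<Longrightarrow> cmod w < 1 \<Longrightarrow> \<Phi> \<phi> w = \<phi> (F w)"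
    using homomorphism_composition[OF R.crossing_disc_axioms S.crossing_disc_axioms into inj add mult scale one]
    by blast
  obtain G where G: "G holomorphic_on unit_disc" "\<And>w. cmod w < 1 \<Longrightarrow> cmod (G w) < 1"
    and \<Psi>G: "\<And>\<phi> w. \<phi> \<in> S.M \<Longrightarrow> cmod w < 1 \<Longrightarrow> \<Psi> \<phi> w = \<phi> (G w)"
  proof (rule homomorphism_composition[OF S.crossing_disc_axioms R.crossing_disc_axioms into' inj' _ _ _ one'])
    show "\<Psi> (\<lambda>z. a z + b z) = (\<lambda>z. \<Psi> a z + \<Psi> b z)" if "a \<in> S.M" "b \<in> S.M" for a b
      using that by (intro lift) (simp_all add: add into' \<Phi>\<Psi> closed)
    show "\<Psi> (\<lambda>z. a z * b z) = (\<lambda>z. \<Psi> a z * \<Psi> b z)" if "a \<in> S.M" "b \<in> S.M" for a b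
      using that by (intro lift) (simp_all add: mult into' \<Phi>\<Psi> closed)
    show "\<Psi> (\<lambda>z. c * a z) = (\<lambda>z. c * \<Psi> a z)" if "a \<in> S.M" for a c
      using that by (intro lift) (simp_all add: scale into' \<Phi>\<Psi> closed_scale)
  qed (use that in blast)+
  have FG: "F (G w) = w" if w: "cmod w < 1" for w
  proof (rule R.M_separates)
    fix \<phi> assume \<phi>: "\<phi> \<in> R.M"
    show "\<phi> (F (G w)) = \<phi> w"
      using \<Phi>F[OF \<phi> G(2)[OF w]] \<Psi>G[OF into[OF \<phi>] w] \<Psi>\<Phi>[OF \<phi>] by simp
  qed (use w F G in auto)
  have GF: "G (F w) = w" if w: "cmod w < 1" for w
  proof (rule S.M_separates)
    fix \<phi> assume \<phi>: "\<phi> \<in> S.M"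
    show "\<phi> (G (F w)) = \<phi> w"
      using \<Psi>G[OF \<phi> F(2)[OF w]] \<Phi>F[OF into'[OF \<phi>] w] \<Phi>\<Psi>[OF \<phi>] by simp
  qed (use w F G in auto)
  obtain c a where "cmod c = 1" "cmod a < 1"
    "\<And>z. cmod z < 1 \<Longrightarrow> F z = c * (z - a) / (1 - cnj a * z)"
    using disc_automorphism[OF F G FG GF] by blast
  moreover have "\<exists>\<psi>\<in>S.M. \<forall>w. cmod w < 1 \<longrightarrow> \<psi> w = \<phi> (F w)" if "\<phi> \<in> R.M" for \<phi>
    using \<Phi>F[OF that] by (intro bexI[of _ "\<Phi> \<phi>"] into that) simp
  ultimately have "(\<forall>z. cmod z < 1 \<longrightarrow> F z = z) \<or> (\<forall>z. cmod z < 1 \<longrightarrow> F z = - z)"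
    by (rule crossing_preserving_automorphism[OF R.crossing_disc_axioms S.crossing_disc_axioms])
  then show "R.M = S.M"
  proof
    assume *: "\<forall>z. cmod z < 1 \<longrightarrow> F z = z"
    have "\<Phi> \<phi> = \<phi>" if "\<phi> \<in> R.M" for \<phi>
    proof
      fix z show "\<Phi> \<phi> z = \<phi> z"
        using \<Phi>F[OF that, of z] * outside[OF that, of z] outside[OF into[OF that], of z]
        by (cases "cmod z < 1") auto
    qed
    then have "\<Phi> ` R.M = R.M" by force
    then show ?thesis using bij by (simp add: bij_betw_def)
  next
    assume *: "\<forall>z. cmod z < 1 \<longrightarrow> F z = - z"
    have \<Phi>_reflect: "\<Phi> \<phi> = (\<lambda>z. \<phi> (- z))" if "\<phi> \<in> R.M" for \<phi>
    proof
      fix z show "\<Phi> \<phi> z = \<phi> (- z)"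
        using \<Phi>F[OF that, of z] * outside[OF that, of "- z"] outside[OF into[OF that], of z]
        by (cases "cmod z < 1") auto
    qed
    \<comment> \<open>Reflection is its own inverse and preserves the algebra for r, so \<Phi> maps
      that algebra onto itself; its image is also the algebra for s.\<close>
    have "\<Phi> ` R.M = R.M"
    proof (intro equalityI subsetI)
      fix \<phi> assume "\<phi> \<in> R.M"
      then show "\<phi> \<in> \<Phi> ` R.M"
        using \<Phi>_reflect[OF R.M_reflect] R.M_reflect by (intro image_eqI[of _ _ "\<lambda>z. \<phi> (- z)"]) auto
    qed (auto simp: \<Phi>_reflect R.M_reflect)
    then show ?thesis using bij by (simp add: bij_betw_def)
  qed
qed

end
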